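(* Let $X$ be a compact Hausdorff space and $E$ be a Banach lattice with order continuous norm. Then for every comonotonic additive and monotone operator $I:C(X)\rightarrow E$ with $I(1)>0$ there exists a unique upper continuous vector capacity $\boldsymbol{\mu}:\Sigma_{up}^{+}(X)\rightarrow E_{+}$ such that $$I(f)=(\mathrm{CB})\int_{X}f\,\mathrm{d}\boldsymbol{\mu}\quad\text{for all }f\in C(X).$$ Moreover, $\boldsymbol{\mu}$ admits a unique extension to a vector capacity on the $\sigma$-algebra $\mathcal{B}(X)$ of Borel subsets of $X$ (also denoted $\boldsymbol{\mu}$) that fulfils the following two properties of regularity: (R1) $\boldsymbol{\mu}(A)=\sup\{\boldsymbol{\mu}(K):K\text{ closed, }K\subset A\}$ for all $A\in\mathcal{B}(X)$; (R2) $\boldsymbol{\mu}(K)=\inf\{\boldsymbol{\mu}(O):O\text{ open, }O\supset K\}$ for all closed sets $K$.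
   Context: $C(X)$ is the Banach lattice of real-valued continuous functions on $X$ with pointwise order and sup norm; $1$ is the constant function. $I(1)>0$ means $I(1)\geq0$ and $I(1)\neq0$. Operators $I:C(X)\to E$ are not assumed linear. $I$ is monotone if $f\leq g$ implies $I(f)\leq I(g)$; $I$ is comonotonic additive if $I(f+g)=I(f)+I(g)$ whenever $f,g$ are comonotone, i.e. $(f(s)-f(t))(g(s)-g(t))\geq0$ for all $s,t\in X$. A Banach lattice has order continuous norm if every monotone order bounded sequence is norm convergent. $E_+$ is its positive cone. $\Sigma_{up}^{+}(X)$ is the lattice of all sets of the form $\{x\in X:f(x)\geq t\}$ with $f\in C(X)$, $t\in\mathbb{R}$. A vector capacity on a lattice of sets $\Sigma$ (containing $\emptyset$ and $X$, closed under finite unions and intersections) is a set function $\boldsymbol{\mu}:\Sigma\to E_+$ with $\boldsymbol{\mu}(\emptyset)=0$ and $\boldsymbol{\mu}(A)\leq\boldsymbol{\mu}(B)$ whenever $A\subset B$ in $\Sigma$. It is upper continuous if $\lim_n\boldsymbol{\mu}(A_n)=\boldsymbol{\mu}(\bigcap_n A_n)$ (norm limit) for every nonincreasing sequence $(A_n)$ in $\Sigma$ with $\bigcap_nA_n\in\Sigma$. The Choquet-Bochner integral is $$(\mathrm{CB})\int_{X}f\,\mathrm{d}\boldsymbol{\mu}=\int_{0}^{+\infty}\boldsymbol{\mu}(\{x\in X:f(x)\geq t\})\,\mathrm{d}t+\int_{-\infty}^{0}\left[\boldsymbol{\mu}(\{x\in X:f(x)\geq t\})-\boldsymbol{\mu}(X)\right]\mathrm{d}t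 ,$$ where both integrals are Bochner integrals with respect to Lebesgue measure. *)

theory Defs
  imports "HOL-Analysis.Analysis" "HOL-Library.Lub_Glb"
begin

section \<open>Banach lattices\<close>

text \<open>The modulus of \<open>x\<close> is \<open>sup x (- x)\<close>.\<close>

class banach_lattice = banach + ordered_real_vector + lattice +
  assumes norm_mono_modulus: "sup x (- x) \<le> sup y (- y) \<Longrightarrow> norm x \<le> norm y"

definition order_continuous_norm :: "'e::banach_lattice itself \<Rightarrow> bool" where
  "order_continuous_norm _ \<longleftrightarrow>
     (\<forall>(u :: nat \<Rightarrow> 'e) a b. monoseq u \<and> range u \<subseteq> {a..b} \<longrightarrow> convergent u)"

instance real :: banach_lattice
  by standard (simp add: sup_real_def max_def split: if_splits)

lemma order_continuous_norm_real: "order_continuous_norm TYPE(real)"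
  unfolding order_continuous_norm_def
proof (intro allI impI)
  fix u :: "nat \<Rightarrow> real" and a b
  assume u: "monoseq u \<and> range u \<subseteq> {a..b}"
  then have "bounded (range u)"
    using bounded_closed_interval bounded_subset by blast
  then have "Bseq u"
    by (simp add: Bseq_eq_bounded)
  then show "convergent u"
    using u Bseq_monoseq_convergent by blast
qed


section \<open>Operators on $C(X)$\<close>

text \<open>
  For a compact space \<open>'a\<close> every continuous function is bounded, so \<open>'a \<Rightarrow>\<^sub>C real\<close> is \<open>C(X)\<close>.
  The library puts no order on this type; the pointwise order is spelled out.
\<close>

definition comonotone :: "('a \<Rightarrow> real) \<Rightarrow> ('a \<Rightarrow> real) \<Rightarrow> bool" where
  "comonotone f g \<longleftrightarrow> (\<forall>s t. (f s - f t) * (g s - g t) \<ge> 0)"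

definition comonotonic_additive ::
  "(('a::topological_space \<Rightarrow>\<^sub>C real) \<Rightarrow> 'e::plus) \<Rightarrow> bool" where
  "comonotonic_additive I \<longleftrightarrow> (\<forall>f g. comonotone (apply_bcontfun f) (apply_bcontfun g) \<longrightarrow>
        I (f + g) = I f + I g)"

definition monotone_operator ::
  "(('a::topological_space \<Rightarrow>\<^sub>C real) \<Rightarrow> 'e::ord) \<Rightarrow> bool" where
  "monotone_operator I \<longleftrightarrow> (\<forall>f g. 
        (\<forall>x. apply_bcontfun f x \<le> apply_bcontfun g x) \<longrightarrow> I f \<le> I g)"


section \<open>Vector capacities\<close>

definition upper_level_sets :: "'a::topological_space set set" where
  "upper_level_sets = {{x. t \<le> apply_bcontfun f x} | (f :: 'a \<Rightarrow>\<^sub>C real) (t :: real). True}"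

definition set_lattice :: "'a set set \<Rightarrow> bool" where
  "set_lattice \<Sigma> \<longleftrightarrow> {} \<in> \<Sigma> \<and> UNIV \<in> \<Sigma> \<and> (\<forall>A\<in>\<Sigma>. \<forall>B\<in>\<Sigma>. A \<union> B \<in> \<Sigma> \<and> A \<inter> B \<in> \<Sigma>)"

text \<open>
  A capacity is a map with domain exactly \<open>\<Sigma>\<close>: membership in \<open>\<rightarrow>\<^sub>E\<close> fixes its value outside
  \<open>\<Sigma>\<close> to \<open>undefined\<close>, so that equality of HOL functions is equality of set functions on \<open>\<Sigma>\<close>.
\<close>

definition vector_capacity :: "'a set set \<Rightarrow> ('a set \<Rightarrow> 'e::banach_lattice) \<Rightarrow> bool" where
  "vector_capacity \<Sigma> \<mu> \<longleftrightarrow>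
     set_lattice \<Sigma> \<and> \<mu> \<in> \<Sigma> \<rightarrow>\<^sub>E {0..} \<and> \<mu> {} = 0 \<and>
     (\<forall>A\<in>\<Sigma>. \<forall>B\<in>\<Sigma>. A \<subseteq> B \<longrightarrow> \<mu> A \<le> \<mu> B)"

definition upper_continuous :: "'a set set \<Rightarrow> ('a set \<Rightarrow> 'e::banach_lattice) \<Rightarrow> bool" where
  "upper_continuous \<Sigma> \<mu> \<longleftrightarrow>
     (\<forall>A :: nat \<Rightarrow> 'a set. range A \<subseteq> \<Sigma> \<and> decseq A \<and> (\<Inter>n. A n) \<in> \<Sigma> \<longrightarrow>
        (\<lambda>n. \<mu> (A n)) \<longlonglongrightarrow> \<mu> (\<Inter>n. A n))"

lemma set_lattice_upper_level_sets:
  "set_lattice (upper_level_sets :: 'a::topological_space set set)"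
proof -
  have *: "\<exists>h::'a \<Rightarrow>\<^sub>C real. \<forall>x. apply_bcontfun h x = F (f x - s) (g x - t)"
    if F: "F = max \<or> F = min" for f g :: "'a \<Rightarrow>\<^sub>C real" and s t :: real and F
  proof -
    obtain a b where ab: "\<And>x. \<bar>f x\<bar> \<le> a" "\<And>x. \<bar>g x\<bar> \<le> b"
      using bounded_apply_bcontfun[of f] bounded_apply_bcontfun[of g]
      unfolding bounded_iff by auto
    have "\<bar>F (f x - s) (g x - t)\<bar> \<le> max (a + \<bar>s\<bar>) (b + \<bar>t\<bar>)" for x
      using F ab(1)[of x] ab(2)[of x] by auto
    then have "bounded (range (\<lambda>x. F (f x - s) (g x - t)))"
      unfolding bounded_iff by auto
    moreover have "continuous_on UNIV (\<lambda>x. F (f x - s) (g x - t))"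
      using F by (auto intro!: continuous_intros)
    ultimately show ?thesis
      by (metis (no_types, lifting) bcontfun_def bcontfunE mem_Collect_eq)
  qed
  have "A \<union> B \<in> upper_level_sets \<and> A \<inter> B \<in> upper_level_sets"
    if AB: "A \<in> upper_level_sets" "B \<in> upper_level_sets" for A B :: "'a set"
  proof -
    obtain f g :: "'a \<Rightarrow>\<^sub>C real" and s t where A: "A = {x. s \<le> f x}" and B: "B = {x. t \<le> g x}"
      using AB unfolding upper_level_sets_def by blast
    obtain h where h: "\<And>x. apply_bcontfun h x = max (f x - s) (g x - t)"
      using *[of max] by blast
    obtain k where k: "\<And>x. apply_bcontfun k x = min (f x - s) (g x - t)"
      using *[of min] by blast
    have "A \<union> B = {x. 0 \<le> h x}" "A \<inter> B = {x. 0 \<le> k x}"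
      by (auto simp: A B h k)
    then show ?thesis
      unfolding upper_level_sets_def by blast
  qed
  moreover have "({} :: 'a set) \<in> upper_level_sets"
    unfolding upper_level_sets_def
    by (intro CollectI exI[of _ "0 :: 'a \<Rightarrow>\<^sub>C real"] exI[of _ "1 :: real"]) auto
  moreover have "(UNIV :: 'a set) \<in> upper_level_sets"
    unfolding upper_level_sets_def
    by (intro CollectI exI[of _ "0 :: 'a \<Rightarrow>\<^sub>C real"] exI[of _ "0 :: real"]) auto
  ultimately show ?thesis
    unfolding set_lattice_def by blast
qed


section \<open>The Bochner integral without separability\<close>

text \<open>
  The library's \<^const>\<open>has_bochner_integral\<close> is restricted to second countable range spaces. For an
  arbitrary Banach space, Borel measurability has to be replaced by strong measurability;
  the rest of the definition is unchanged. On second countable spaces the two notions agree.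
\<close>

definition strongly_measurable ::
  "'a measure \<Rightarrow> ('a \<Rightarrow> 'b::real_normed_vector) \<Rightarrow> bool" where
  "strongly_measurable M f \<longleftrightarrow>
     (\<exists>s :: nat \<Rightarrow> 'a \<Rightarrow> 'b. (\<forall>i. simple_function M (s i)) \<and>
        (AE x in M. (\<lambda>i. s i x) \<longlonglongrightarrow> f x))"

definition has_strong_bochner_integral ::
  "'a measure \<Rightarrow> ('a \<Rightarrow> 'b::real_normed_vector) \<Rightarrow> 'b \<Rightarrow> bool" where
  "has_strong_bochner_integral M f v \<longleftrightarrow>
     strongly_measurable M f \<and>
     (\<exists>s :: nat \<Rightarrow> 'a \<Rightarrow> 'b. (\<forall>i. Bochner_Integration.simple_bochner_integrable M (s i)) \<and>
        (\<lambda>i. \<integral>\<^sup>+x. norm (f x - s i x) \<partial>M) \<longlonglongrightarrow> 0 \<and>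
        (\<lambda>i. Bochner_Integration.simple_bochner_integral M (s i)) \<longlonglongrightarrow> v)"

lemma borel_measurable_lebesgue_AE:
  assumes "g \<in> borel_measurable lebesgue" "AE x in lebesgue. g x = f x"
  shows "f \<in> borel_measurable lebesgue"
proof (rule measurableI)
  fix A :: "'b set" assume "A \<in> sets borel"
  then have "g -` A \<inter> space lebesgue \<in> sets lebesgue"
    using assms(1) by (rule measurable_sets[rotated])
  moreover have "AE x in lebesgue. x \<in> g -` A \<inter> space lebesgue \<longleftrightarrow> x \<in> f -` A \<inter> space lebesgue"
    using assms(2) by eventually_elim auto
  ultimately show "f -` A \<inter> space lebesgue \<in> sets lebesgue"
    using completion.in_sets_AE by (metis Int_lower2)
qed auto

lemma strongly_measurable_lebesgue_iff:
  fixes f :: "'a::euclidean_space \<Rightarrow> 'b::{real_normed_vector, second_countable_topology}"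
  shows "strongly_measurable lebesgue f \<longleftrightarrow> f \<in> borel_measurable lebesgue"
proof
  assume "strongly_measurable lebesgue f"
  then obtain s where s: "\<And>i. simple_function lebesgue (s i)"
    "AE x in lebesgue. (\<lambda>i. s i x) \<longlonglongrightarrow> f x"
    unfolding strongly_measurable_def by blast
  define N where "N = {x. \<not> (\<lambda>i. s i x) \<longlonglongrightarrow> f x}"
  have N: "N \<in> null_sets lebesgue" "{x. \<not> (\<lambda>i. s i x) \<longlonglongrightarrow> f x} \<subseteq> N"
    using s(2) by (auto simp: N_def completion.AE_iff_null_sets)
  define g where "g x = (if x \<in> N then 0 else f x)" for x
  have "g \<in> borel_measurable lebesgue"
  proof (rule borel_measurable_LIMSEQ_metric)
    show "(\<lambda>x. if x \<in> N then 0 else s i x) \<in> borel_measurable lebesgue" for i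
      using s(1)[of i] N(1)
      by (intro measurable_If_set) (auto simp: borel_measurable_simple_function)
    show "(\<lambda>i. if x \<in> N then 0 else s i x) \<longlonglongrightarrow> g x" for x
      using N(2) by (auto simp: g_def)
  qed
  moreover have "AE x in lebesgue. g x = f x"
    by (rule AE_I'[OF N(1)]) (auto simp: g_def)
  ultimately show "f \<in> borel_measurable lebesgue"
    by (rule borel_measurable_lebesgue_AE)
next
  assume "f \<in> borel_measurable lebesgue"
  from borel_measurable_implies_sequence_metric[OF this, of 0]
  obtain F where "\<forall>i. simple_function lebesgue (F i)" "\<forall>x\<in>space lebesgue. (\<lambda>i. F i x) \<longlonglongrightarrow> f x"
    by blast
  then show "strongly_measurable lebesgue f"
    unfolding strongly_measurable_def by (intro exI[of _ F]) simp
qed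

lemma has_strong_bochner_integral_lebesgue_iff:
  fixes f :: "'a::euclidean_space \<Rightarrow> 'b::{real_normed_vector, second_countable_topology}"
  shows "has_strong_bochner_integral lebesgue f v \<longleftrightarrow> has_bochner_integral lebesgue f v"
  unfolding has_strong_bochner_integral_def strongly_measurable_lebesgue_iff
    has_bochner_integral.simps by blast


section \<open>The Choquet-Bochner integral\<close>

text \<open>
  The relation states that both Bochner integrals exist and that their sum is \<open>v\<close>.
\<close>

definition has_choquet_bochner_integral ::
  "('a set \<Rightarrow> 'e::banach_lattice) \<Rightarrow> ('a \<Rightarrow> real) \<Rightarrow> 'e \<Rightarrow> bool" where
  "has_choquet_bochner_integral \<mu> f v \<longleftrightarrow>
     (\<exists>a b.
        has_strong_bochner_integral lebesgue
          (\<lambda>t::real. indicator {0..} t *\<^sub>R \<mu> {x. t \<le> f x}) a \<and>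
        has_strong_bochner_integral lebesgue
          (\<lambda>t::real. indicator {..0} t *\<^sub>R (\<mu> {x. t \<le> f x} - \<mu> UNIV)) b \<and>
        v = a + b)"


section \<open>Representation and regular extension\<close>

definition represents ::
  "('a::topological_space set \<Rightarrow> 'e::banach_lattice) \<Rightarrow> (('a \<Rightarrow>\<^sub>C real) \<Rightarrow> 'e) \<Rightarrow> bool" where
  "represents \<mu> I \<longleftrightarrow> (\<forall>f. has_choquet_bochner_integral \<mu> (apply_bcontfun f) (I f))"

definition inner_regular :: "('a::topological_space set \<Rightarrow> 'e::banach_lattice) \<Rightarrow> bool" where
  "inner_regular \<nu> \<longleftrightarrow>
     (\<forall>A\<in>sets borel. isLub UNIV {\<nu> K | K. closed K \<and> K \<subseteq> A} (\<nu> A))"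

definition outer_regular_closed ::
  "('a::topological_space set \<Rightarrow> 'e::banach_lattice) \<Rightarrow> bool" where
  "outer_regular_closed \<nu> \<longleftrightarrow>
     (\<forall>K. closed K \<longrightarrow> isGlb UNIV {\<nu> U | U. open U \<and> K \<subseteq> U} (\<nu> K))"

end

theory Submission
  imports Defs
begin

text \<open>
  For an arbitrary set \<open>A\<close> let \<open>cap A\<close> be the infimum of \<open>I h\<close> over all continuous \<open>h\<close> dominating
  the indicator of \<open>A\<close>. The infimum exists because these \<open>h\<close> form a downward directed family
  and order continuity of the norm makes directed families norm Cauchy. By compactness \<open>cap\<close> is
  continuous along decreasing sequences of closed sets.

  Slicing \<open>f\<close> into the layers of height \<open>1/m\<close>, which are pairwise comonotone, and comparing \<open>m\<close> times
  each layer with the indicators of its two bounding level sets traps \<open>I f\<close> between the lower and the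
  upper Riemann sum of \<open>t \<mapsto> cap {f \<ge> t}\<close>, which differ by at most \<open>I 1 / m\<close>. Left continuity of this
  map identifies the limit of the Riemann sums with the Bochner integral. Conversely, a continuous
  function squeezed between the indicators of \<open>{f \<ge> t}\<close> and \<open>{f \<ge> t - 1/n}\<close> shows that every
  representing upper continuous capacity equals \<open>cap\<close> on the upper level sets.

  The regular extension is \<open>sup {cap K | K closed, K \<subseteq> A}\<close>; Urysohn's lemma gives its uniqueness.
\<close>

section \<open>Order and norm in Banach lattices\<close>

lemma modulus_nonneg: "0 \<le> sup x (- x)" for x :: "'e::banach_lattice"
proof -
  have "x + - x \<le> sup x (- x) + sup x (- x)"
    by (intro add_mono) auto
  then have "(1/2) *\<^sub>R 0 \<le> (1/2) *\<^sub>R (sup x (- x) + sup x (- x))"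
    by (intro scaleR_left_mono) auto
  then show ?thesis
    by (simp flip: scaleR_2)
qed

lemma norm_mono_nonneg:
  fixes x y :: "'e::banach_lattice"
  assumes "0 \<le> x" "x \<le> y"
  shows "norm x \<le> norm y"
proof -
  have "sup z (- z) = z" if "0 \<le> z" for z :: 'e
    using that by (intro sup_absorb1) (metis neg_le_0_iff_le order_trans)
  then show ?thesis
    using assms by (intro norm_mono_modulus) auto
qed

text \<open>The negative part \<open>w\<close> of the limit lies below the modulus of
  \<open>u n - x\<close>, because \<open>- x \<le> u n - x\<close> when \<open>u n\<close> is
  positive. The lattice norm turns this into a bound of \<open>norm w\<close> by a null sequence.
  Thus the positive cone is closed, and inequalities survive norm limits.\<close>

lemma nonneg_limit:
  fixes u :: "nat \<Rightarrow> 'e::banach_lattice"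
  assumes u: "u \<longlonglongrightarrow> x" and pos: "\<And>n. 0 \<le> u n"
  shows "0 \<le> x"
proof -
  define w where "w = sup (- x) 0"
  have "norm w \<le> norm (u n - x)" for n
  proof (rule norm_mono_modulus)
    have "- w \<le> w"
      unfolding w_def by (metis neg_le_0_iff_le order_trans sup_ge2)
    then have "sup w (- w) = w"
      by (simp add: sup_absorb1)
    moreover have "- x \<le> sup (u n - x) (- (u n - x))"
      using pos[of n] by (intro le_supI1) simp
    ultimately show "sup w (- w) \<le> sup (u n - x) (- (u n - x))"
      by (metis le_supI modulus_nonneg w_def)
  qed
  moreover have "(\<lambda>n. norm (u n - x)) \<longlonglongrightarrow> 0"
    using u LIM_zero tendsto_norm_zero by blast
  ultimately have "norm w \<le> 0"
    by (meson LIMSEQ_le_const)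
  then show ?thesis
    unfolding w_def by (metis neg_le_0_iff_le norm_le_zero_iff sup_ge1)
qed

lemma limit_mono:
  fixes u v :: "nat \<Rightarrow> 'e::banach_lattice"
  assumes "u \<longlonglongrightarrow> x" "v \<longlonglongrightarrow> y" "\<And>n. u n \<le> v n"
  shows "x \<le> y"
  using nonneg_limit[OF tendsto_diff[OF assms(2,1)]] assms(3) by simp

text \<open>The difference \<open>v i - u i\<close> lies between 0 and \<open>w i - u i\<close>, so
  its norm is dominated by that of a family tending to 0.\<close>

lemma order_squeeze:
  fixes u v w :: "'b \<Rightarrow> 'e::banach_lattice"
  assumes u: "(u \<longlongrightarrow> x) F" and w: "(w \<longlongrightarrow> x) F"
    and le: "\<And>i. u i \<le> v i" "\<And>i. v i \<le> w i"
  shows "(v \<longlongrightarrow> x) F"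
proof -
  have "((\<lambda>i. w i - u i) \<longlongrightarrow> 0) F"
    using tendsto_diff[OF w u] by simp
  then have "((\<lambda>i. v i - u i) \<longlongrightarrow> 0) F"
    using le by (elim Lim_null_comparison[rotated, OF tendsto_norm_zero])
      (auto intro!: always_eventually norm_mono_nonneg)
  from tendsto_add[OF this u] show ?thesis by simp
qed

lemma le_archimedean:
  fixes x y e :: "'e::banach_lattice"
  assumes "\<And>n. x \<le> y + (1 / real (Suc n)) *\<^sub>R e"
  shows "x \<le> y"
proof (rule limit_mono[OF tendsto_const _ assms])
  have "(\<lambda>n. y + (1 / real (Suc n)) *\<^sub>R e) \<longlonglongrightarrow> y + 0 *\<^sub>R e"
    using LIMSEQ_inverse_real_of_nat
    by (intro tendsto_intros) (simp add: divide_inverse)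
  then show "(\<lambda>n. y + (1 / real (Suc n)) *\<^sub>R e) \<longlonglongrightarrow> y" by simp
qed

lemma isGlb_UNIV_iff:
  "isGlb UNIV S x \<longleftrightarrow> (\<forall>y\<in>S. x \<le> y) \<and> (\<forall>z. (\<forall>y\<in>S. z \<le> y) \<longrightarrow> z \<le> x)"
  by (auto simp: isGlb_def isLb_def greatestP_def setge_def setle_def)

lemma isLub_UNIV_iff:
  "isLub UNIV S x \<longleftrightarrow> (\<forall>y\<in>S. y \<le> x) \<and> (\<forall>z. (\<forall>y\<in>S. y \<le> z) \<longrightarrow> x \<le> z)"
  by (auto simp: isLub_def isUb_def leastP_def setge_def setle_def)

lemma isGlb_unique_order: "isGlb UNIV S x \<Longrightarrow> isGlb UNIV S y \<Longrightarrow> x = y" for x :: "'b::order"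
  by (auto simp: isGlb_UNIV_iff intro: order_antisym)

lemma isLub_unique_order: "isLub UNIV S x \<Longrightarrow> isLub UNIV S y \<Longrightarrow> x = y" for x :: "'b::order"
  by (auto simp: isLub_UNIV_iff intro: order_antisym)

section \<open>Directed infima and suprema from order continuity of the norm\<close>

lemma decseq_bounded_convergent:
  fixes u :: "nat \<Rightarrow> 'e::banach_lattice"
  assumes oc: "order_continuous_norm TYPE('e)" and "decseq u" and "\<And>n. a \<le> u n"
  obtains x where "u \<longlonglongrightarrow> x" "\<And>n. x \<le> u n" "a \<le> x"
proof -
  have "range u \<subseteq> {a..u 0}"
    using assms by (auto simp: decseq_def)
  then have "convergent u"
    using oc assms(2) unfolding order_continuous_norm_def by (metis monoseq_iff)
  then obtain x where x: "u \<longlonglongrightarrow> x" by (auto simp: convergent_def)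
  have "x \<le> u n" for n
    using assms(2) by (intro limit_mono[OF LIMSEQ_ignore_initial_segment[OF x, of n] tendsto_const])
      (auto simp: decseq_def)
  moreover have "a \<le> x"
    using assms(3) limit_mono[OF tendsto_const x] by blast
  ultimately show ?thesis using that x by blast
qed

text \<open>This carries order continuity from sequences to directed families. For every
  \<open>e > 0\<close> some element of \<open>D\<close> has all smaller elements of \<open>D\<close>
  within distance \<open>e\<close>; a decreasing sequence threaded through such elements converges,
  and its limit is the infimum of all of \<open>D\<close>.\<close>

lemma downward_directed_isGlb:
  fixes D :: "'e::banach_lattice set"
  assumes oc: "order_continuous_norm TYPE('e)" and ne: "D \<noteq> {}"
    and dir: "\<And>u v. u \<in> D \<Longrightarrow> v \<in> D \<Longrightarrow> \<exists>w\<in>D. w \<le> u \<and> w \<le> v"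
    and lb: "\<And>u. u \<in> D \<Longrightarrow> a \<le> u"
  shows "\<exists>x. isGlb UNIV D x"
proof -
  have small: "\<exists>u\<in>D. \<forall>v\<in>D. v \<le> u \<longrightarrow> norm (u - v) < e" if "e > 0" for e
  proof (rule ccontr)
    assume "\<not> ?thesis"
    then have "\<forall>u\<in>D. \<exists>v\<in>D. v \<le> u \<and> e \<le> norm (u - v)"
      by (meson not_le)
    then obtain f where f: "\<And>u. u \<in> D \<Longrightarrow> f u \<in> D \<and> f u \<le> u \<and> e \<le> norm (u - f u)"
      by metis
    \<comment> \<open>Iterating \<open>f\<close> from \<open>d\<close> gives a decreasing sequence
      bounded below by \<open>a\<close> whose consecutive differences have norm at least
      \<open>e\<close>, so it cannot converge.\<close>
    obtain d where "d \<in> D" using ne by blast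
    define u where "u n = (f ^^ n) d" for n
    have uD: "u n \<in> D" for n
      by (induction n) (auto simp: u_def \<open>d \<in> D\<close> f)
    have Suc: "u (Suc n) = f (u n)" for n by (simp add: u_def)
    have dec: "decseq u"
      using f[OF uD] by (auto simp: decseq_Suc_iff Suc)
    obtain x where x: "u \<longlonglongrightarrow> x"
      using decseq_bounded_convergent[OF oc dec lb[OF uD]] by blast
    have "(\<lambda>n. norm (u n - u (Suc n))) \<longlonglongrightarrow> norm (x - x)"
      by (intro tendsto_intros x LIMSEQ_Suc)
    then have "e \<le> norm (x - x)"
      by (rule LIMSEQ_le_const) (use f[OF uD] in \<open>simp add: Suc\<close>)
    then show False using that by simp
  qed
  then have "\<forall>n. \<exists>u\<in>D. \<forall>v\<in>D. v \<le> u \<longrightarrow> norm (u - v) < 1 / real (Suc n)"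
    by simp
  then obtain p where p: "\<And>n. p n \<in> D" "\<And>n v. v \<in> D \<Longrightarrow> v \<le> p n \<Longrightarrow> norm (p n - v) < 1 / real (Suc n)"
    by metis
  obtain m where m: "\<And>u v. u \<in> D \<Longrightarrow> v \<in> D \<Longrightarrow> m u v \<in> D \<and> m u v \<le> u \<and> m u v \<le> v"
    using dir by metis
  \<comment> \<open>The \<open>p n\<close> need not decrease. Choosing each new term below both the
    previous term and \<open>p (Suc n)\<close> makes the sequence decreasing, and staying below
    \<open>p n\<close> passes the smallness of \<open>p n\<close> on to \<open>u n\<close>.\<close>
  define u where "u = rec_nat (p 0) (\<lambda>n w. m w (p (Suc n)))"
  have u0: "u 0 = p 0" and uS: "u (Suc n) = m (u n) (p (Suc n))" for n
    by (auto simp: u_def)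
  have uD: "u n \<in> D" for n
    by (induction n) (simp_all add: u0 uS m p(1))
  have up: "u n \<le> p n" for n
    by (cases n) (simp_all add: u0 uS m[OF uD p(1)])
  have dec: "decseq u"
    by (simp add: decseq_Suc_iff uS m[OF uD p(1)])
  have usmall: "norm (u n - v) < 2 / real (Suc n)" if "v \<in> D" "v \<le> u n" for n v
  proof -
    have "norm (u n - v) \<le> norm (p n - v)"
      using that up[of n] by (intro norm_mono_nonneg) auto
    also have "\<dots> < 1 / real (Suc n)" by (rule p(2)[OF that(1) order_trans[OF that(2) up]])
    also have "\<dots> \<le> 2 / real (Suc n)" by (simp add: divide_right_mono)
    finally show ?thesis .
  qed
  obtain x where x: "u \<longlonglongrightarrow> x"
    using decseq_bounded_convergent[OF oc dec lb[OF uD]] by blast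
  have "x \<le> w" if w: "w \<in> D" for w
  proof -
    have v: "m (u n) w \<in> D" "m (u n) w \<le> u n" "m (u n) w \<le> w" for n
      using m[OF uD w] by auto
    \<comment> \<open>The element \<open>m (u n) w\<close> lies below \<open>w\<close> and, being in
      \<open>D\<close> and below \<open>u n\<close>, is close to \<open>u n\<close>. Hence it tends
      to the same limit \<open>x\<close>, which forces \<open>x \<le> w\<close>.\<close>
    have "(\<lambda>n. u n - m (u n) w) \<longlonglongrightarrow> 0"
    proof (rule Lim_null_comparison)
      show "\<forall>\<^sub>F n in sequentially. norm (u n - m (u n) w) \<le> 2 * (1 / real (Suc n))"
        using usmall[OF v(1,2)] by (auto intro!: always_eventually less_imp_le)
      have "(\<lambda>n. 2 * (1 / real (Suc n))) \<longlonglongrightarrow> 2 * 0"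
        using LIMSEQ_inverse_real_of_nat by (intro tendsto_intros) (simp add: divide_inverse)
      then show "(\<lambda>n. 2 * (1 / real (Suc n))) \<longlonglongrightarrow> 0" by simp
    qed
    from tendsto_diff[OF x this] have "(\<lambda>n. m (u n) w) \<longlonglongrightarrow> x" by simp
    then show ?thesis by (rule limit_mono[OF _ tendsto_const v(3)])
  qed
  moreover have "z \<le> x" if "\<forall>y\<in>D. z \<le> y" for z
    by (rule limit_mono[OF tendsto_const x]) (use that uD in blast)
  ultimately show ?thesis unfolding isGlb_UNIV_iff by blast
qed

lemma upward_directed_isLub:
  fixes D :: "'e::banach_lattice set"
  assumes oc: "order_continuous_norm TYPE('e)" and ne: "D \<noteq> {}"
    and dir: "\<And>u v. u \<in> D \<Longrightarrow> v \<in> D \<Longrightarrow> \<exists>w\<in>D. u \<le> w \<and> v \<le> w"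
    and ub: "\<And>u. u \<in> D \<Longrightarrow> u \<le> a"
  shows "\<exists>x. isLub UNIV D x"
proof -
  have "\<exists>x. isGlb UNIV (uminus ` D) x"
  proof (rule downward_directed_isGlb[OF oc, of _ "- a"])
    show "\<exists>w\<in>uminus ` D. w \<le> u \<and> w \<le> v" if uv: "u \<in> uminus ` D" "v \<in> uminus ` D" for u v
    proof -
      obtain u' v' where "u' \<in> D" "v' \<in> D" and [simp]: "u = - u'" "v = - v'"
        using uv by blast
      then obtain w where "w \<in> D" "u' \<le> w" "v' \<le> w" using dir by blast
      then show ?thesis by (intro bexI[of _ "- w"]) auto
    qed
  qed (use ne ub in auto)
  then obtain x where x: "\<forall>y\<in>D. x \<le> - y" "\<And>z. \<forall>y\<in>D. z \<le> - y \<Longrightarrow> z \<le> x"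
    by (auto simp: isGlb_UNIV_iff)
  have "- x \<le> z" if "\<forall>y\<in>D. y \<le> z" for z
  proof -
    have "- z \<le> x" using that by (intro x(2)) simp
    then show ?thesis by (subst minus_le_iff)
  qed
  moreover have "y \<le> - x" if "y \<in> D" for y
    using x(1) that le_minus_iff[of x y] by blast
  ultimately show ?thesis unfolding isLub_UNIV_iff by blast
qed


section \<open>Bochner integrals as limits of Riemann sums\<close>

text \<open>The sets \<open>A i\<close> may overlap: additivity of the simple integral reduces the
  sum to one indicator, whose integral is computed as a nonnegative integral and then carried over
  by the linear map \<open>r \<mapsto> r *\<^sub>R d\<close>.\<close>

lemma simple_bochner_sum_indicator:
  fixes c :: "'i \<Rightarrow> 'b::real_normed_vector"
  assumes "finite S" "\<And>i. i \<in> S \<Longrightarrow> A i \<in> sets M" "\<And>i. i \<in> S \<Longrightarrow> emeasure M (A i) < \<infinity>"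
  shows "Bochner_Integration.simple_bochner_integrable M (\<lambda>x. \<Sum>i\<in>S. indicator (A i) x *\<^sub>R c i)"
    and "Bochner_Integration.simple_bochner_integral M (\<lambda>x. \<Sum>i\<in>S. indicator (A i) x *\<^sub>R c i) =
      (\<Sum>i\<in>S. measure M (A i) *\<^sub>R c i)"
proof -
  have ind: "Bochner_Integration.simple_bochner_integrable M (indicator B :: _ \<Rightarrow> real)"
    and ind_int: "Bochner_Integration.simple_bochner_integral M (indicator B :: _ \<Rightarrow> real) = measure M B"
    if B: "B \<in> sets M" "emeasure M B < \<infinity>" for B
  proof -
    have "{y \<in> space M. (indicator B y :: real) \<noteq> 0} = B"
      using B sets.sets_into_space by (auto simp: indicator_def)
    with B show I: "Bochner_Integration.simple_bochner_integrable M (indicator B :: _ \<Rightarrow> real)"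
      by (intro simple_bochner_integrable.intros) auto
    have "ennreal (Bochner_Integration.simple_bochner_integral M (indicator B :: _ \<Rightarrow> real)) = emeasure M B"
      using B by (subst simple_bochner_integral_eq_nn_integral[OF I]) (auto simp: ennreal_indicator)
    also have "\<dots> = ennreal (measure M B)"
      using B by (simp add: emeasure_eq_ennreal_measure)
    finally show "Bochner_Integration.simple_bochner_integral M (indicator B :: _ \<Rightarrow> real) = measure M B"
      by (subst (asm) ennreal_inj) auto
  qed
  have one: "Bochner_Integration.simple_bochner_integrable M (\<lambda>x. indicator B x *\<^sub>R d)"
      "Bochner_Integration.simple_bochner_integral M (\<lambda>x. indicator B x *\<^sub>R d) = measure M B *\<^sub>R d"
    if B: "B \<in> sets M" "emeasure M B < \<infinity>" for B and d :: 'b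
  proof -
    show "Bochner_Integration.simple_bochner_integrable M (\<lambda>x. indicator B x *\<^sub>R d)"
      using simple_bochner_integrable_compose2[of "\<lambda>x y. x *\<^sub>R d", OF _ ind[OF B] ind[OF B]] by simp
    have "linear (\<lambda>r::real. r *\<^sub>R d)"
      by (simp add: linear_scale_left linear_iff scaleR_left_distrib)
    from simple_bochner_integral_linear[OF this ind[OF B]]
    show "Bochner_Integration.simple_bochner_integral M (\<lambda>x. indicator B x *\<^sub>R d) = measure M B *\<^sub>R d"
      by (simp add: ind_int[OF B])
  qed
  have "Bochner_Integration.simple_bochner_integrable M (\<lambda>x. \<Sum>i\<in>S. indicator (A i) x *\<^sub>R c i) \<and>
    Bochner_Integration.simple_bochner_integral M (\<lambda>x. \<Sum>i\<in>S. indicator (A i) x *\<^sub>R c i) =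
      (\<Sum>i\<in>S. measure M (A i) *\<^sub>R c i)"
    using assms
  proof (induction S rule: finite_induct)
    case empty
    have "Bochner_Integration.simple_bochner_integrable M (\<lambda>x. 0 :: 'b)"
      by (intro simple_bochner_integrable.intros) auto
    then show ?case
      by (auto simp: simple_bochner_integral_def intro!: sum.neutral)
  next
    case (insert i S)
    then show ?case
      using one[of "A i" "c i"]
        simple_bochner_integrable_compose2[of "(+)" M "\<lambda>x. indicator (A i) x *\<^sub>R c i"
          "\<lambda>x. \<Sum>i\<in>S. indicator (A i) x *\<^sub>R c i"]
      by (simp add: simple_bochner_integral_add del: sum_indicator_scaleR)
  qed
  then show "Bochner_Integration.simple_bochner_integrable M (\<lambda>x. \<Sum>i\<in>S. indicator (A i) x *\<^sub>R c i)"
    and "Bochner_Integration.simple_bochner_integral M (\<lambda>x. \<Sum>i\<in>S. indicator (A i) x *\<^sub>R c i) =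
      (\<Sum>i\<in>S. measure M (A i) *\<^sub>R c i)" by auto
qed

text \<open>Norms of the differences of simple functions are again simple and real valued, and for
  real functions strong and Borel measurability coincide. This makes the error integrals accessible
  to the theory of nonnegative integrals although the range space may be nonseparable.\<close>

lemma strongly_measurable_norm_diff:
  fixes f :: "'a::euclidean_space \<Rightarrow> 'b::real_normed_vector"
  assumes "strongly_measurable lebesgue f" "simple_function lebesgue s"
  shows "(\<lambda>x. norm (f x - s x)) \<in> borel_measurable lebesgue"
proof -
  obtain t where t: "\<And>i. simple_function lebesgue (t i)" "AE x in lebesgue. (\<lambda>i. t i x) \<longlonglongrightarrow> f x"
    using assms(1) unfolding strongly_measurable_def by blast
  have "AE x in lebesgue. (\<lambda>i. norm (t i x - s x)) \<longlonglongrightarrow> norm (f x - s x)"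
    using t(2) by eventually_elim (rule tendsto_norm[OF tendsto_diff[OF _ tendsto_const]])
  moreover have "simple_function lebesgue (\<lambda>x. norm (t i x - s x))" for i
    using simple_function_compose2[OF t(1) assms(2), of "\<lambda>a b. norm (a - b)"] .
  ultimately have "strongly_measurable lebesgue (\<lambda>x. norm (f x - s x))"
    unfolding strongly_measurable_def by (intro exI[of _ "\<lambda>i x. norm (t i x - s x)"]) simp
  then show ?thesis
    by (simp add: strongly_measurable_lebesgue_iff)
qed

text \<open>The definition supplies only one approximating sequence \<open>t\<close>. By the
  triangle inequality the simple integrals of \<open>s i\<close> and \<open>t i\<close> differ by at
  most the sum of the two error integrals, so every approximating sequence yields the same
  value.\<close>

lemma has_strong_bochner_integral_LIMSEQ:
  fixes f :: "'a::euclidean_space \<Rightarrow> 'b::real_normed_vector"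
  assumes f: "has_strong_bochner_integral lebesgue f v"
    and s: "\<And>i. Bochner_Integration.simple_bochner_integrable lebesgue (s i)"
      "(\<lambda>i. \<integral>\<^sup>+x. norm (f x - s i x) \<partial>lebesgue) \<longlonglongrightarrow> 0"
  shows "(\<lambda>i. Bochner_Integration.simple_bochner_integral lebesgue (s i)) \<longlonglongrightarrow> v"
proof -
  let ?sbi = "Bochner_Integration.simple_bochner_integral lebesgue"
  obtain t where sm: "strongly_measurable lebesgue f"
    and t: "\<And>i. Bochner_Integration.simple_bochner_integrable lebesgue (t i)"
      "(\<lambda>i. \<integral>\<^sup>+x. norm (f x - t i x) \<partial>lebesgue) \<longlonglongrightarrow> 0" "(\<lambda>i. ?sbi (t i)) \<longlonglongrightarrow> v"
    using f unfolding has_strong_bochner_integral_def by blast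
  have meas: "(\<lambda>x. norm (f x - s i x)) \<in> borel_measurable lebesgue"
    "(\<lambda>x. norm (f x - t i x)) \<in> borel_measurable lebesgue" for i
    using strongly_measurable_norm_diff[OF sm] s(1)[of i] t(1)[of i]
    by (auto elim: simple_bochner_integrable.cases)
  have le: "ennreal (norm (?sbi (s i) - ?sbi (t i))) \<le>
    (\<integral>\<^sup>+x. norm (f x - s i x) \<partial>lebesgue) + (\<integral>\<^sup>+x. norm (f x - t i x) \<partial>lebesgue)" for i
  proof -
    have "ennreal (norm (?sbi (s i) - ?sbi (t i))) = norm (?sbi (\<lambda>x. s i x - t i x))"
      using s t by (subst simple_bochner_integral_diff) auto
    also have "\<dots> \<le> ?sbi (\<lambda>x. norm (s i x - t i x))"
      using simple_bochner_integrable_compose2[of "(-)" lebesgue "s i" "t i"] s t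
      by (auto intro!: simple_bochner_integral_norm_bound)
    also have "\<dots> = (\<integral>\<^sup>+x. norm (s i x - t i x) \<partial>lebesgue)"
      using simple_bochner_integrable_compose2[of "\<lambda>x y. norm (x - y)" lebesgue "s i" "t i"] s t
      by (auto intro!: simple_bochner_integral_eq_nn_integral)
    also have "\<dots> \<le> (\<integral>\<^sup>+x. ennreal (norm (f x - s i x)) + ennreal (norm (f x - t i x)) \<partial>lebesgue)"
    proof (intro nn_integral_mono)
      fix x
      have "norm (s i x - t i x) \<le> norm (f x - s i x) + norm (f x - t i x)"
        by (metis dual_order.refl norm_diff_triangle_le norm_minus_commute)
      then show "ennreal (norm (s i x - t i x)) \<le> ennreal (norm (f x - s i x)) + ennreal (norm (f x - t i x))"
        by (simp flip: ennreal_plus)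
    qed
    also have "\<dots> = (\<integral>\<^sup>+x. norm (f x - s i x) \<partial>lebesgue) + (\<integral>\<^sup>+x. norm (f x - t i x) \<partial>lebesgue)"
      using meas by (intro nn_integral_add) auto
    finally show ?thesis .
  qed
  have lim: "(\<lambda>i. (\<integral>\<^sup>+x. norm (f x - s i x) \<partial>lebesgue) + (\<integral>\<^sup>+x. norm (f x - t i x) \<partial>lebesgue)) \<longlonglongrightarrow> 0"
    using tendsto_add[OF s(2) t(2)] by simp
  have "(\<lambda>i. ennreal (norm (?sbi (s i) - ?sbi (t i)))) \<longlonglongrightarrow> 0"
    by (rule tendsto_sandwich[OF _ always_eventually[OF allI[OF le]] tendsto_const lim]) simp
  then have "(\<lambda>i. ?sbi (s i) - ?sbi (t i)) \<longlonglongrightarrow> 0"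
    by (subst (asm) ennreal_tendsto_0_iff) (auto simp: tendsto_norm_zero_iff)
  from tendsto_add[OF this t(3)] show ?thesis by simp
qed

text \<open>On each grid cell the step function takes the value of \<open>\<phi>\<close> at the left
  endpoint; these endpoints approach \<open>t\<close> from the left, so left continuity gives
  pointwise convergence, and boundedness on a bounded interval gives dominated convergence. An
  integer length \<open>k\<close> lets every grid of mesh \<open>1 / real (Suc n)\<close> end
  exactly at \<open>a + real k\<close>. The value of \<open>F\<close> at that endpoint is left
  free.\<close>

lemma left_continuous_step_approximation:
  fixes \<phi> F :: "real \<Rightarrow> 'b::real_normed_vector" and a :: real and k :: nat
  assumes bound: "\<And>t. norm (\<phi> t) \<le> B"
    and left: "\<And>t. continuous (at t within {..t}) \<phi>"
    and F_in: "\<And>t. a \<le> t \<Longrightarrow> t < a + real k \<Longrightarrow> F t = \<phi> t"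
    and F_out: "\<And>t. t \<notin> {a..a + real k} \<Longrightarrow> F t = 0"
  obtains s where
    "\<And>n. Bochner_Integration.simple_bochner_integrable lebesgue (s n)"
    "\<And>n. Bochner_Integration.simple_bochner_integral lebesgue (s n) =
       (1 / real (Suc n)) *\<^sub>R (\<Sum>i<k * Suc n. \<phi> (a + real i / real (Suc n)))"
    "AE t in lebesgue. (\<lambda>n. s n t) \<longlonglongrightarrow> F t"
    "(\<lambda>n. \<integral>\<^sup>+t. norm (F t - s n t) \<partial>lebesgue) \<longlonglongrightarrow> 0"
proof -
  define A where "A n i = {a + real i / real (Suc n)..<a + real (Suc i) / real (Suc n)}" for n i :: nat
  define s where "s n t = (\<Sum>i<k * Suc n. indicator (A n i) t *\<^sub>R \<phi> (a + real i / real (Suc n)))" for n t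
  have A_sets: "A n i \<in> sets lebesgue" for n i
    by (simp add: A_def)
  have A_em: "emeasure lebesgue (A n i) = ennreal (1 / real (Suc n))" for n i
  proof -
    have "a + real i / real (Suc n) \<le> a + real (Suc i) / real (Suc n)"
      by (simp add: divide_right_mono)
    then show ?thesis
      unfolding A_def by (simp add: emeasure_lborel_Ico flip: diff_divide_distrib)
  qed
  have A_meas: "measure lebesgue (A n i) = 1 / real (Suc n)" for n i
    by (simp add: measure_def A_em)
  have s_int: "Bochner_Integration.simple_bochner_integrable lebesgue (s n)"
    and s_val: "Bochner_Integration.simple_bochner_integral lebesgue (s n) =
       (1 / real (Suc n)) *\<^sub>R (\<Sum>i<k * Suc n. \<phi> (a + real i / real (Suc n)))" for n
    unfolding s_def
    by (rule simple_bochner_sum_indicator; simp add: A_sets A_em)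
       (subst simple_bochner_sum_indicator; simp add: A_sets A_em A_meas scaleR_sum_right)
  \<comment> \<open>Exactly one half-open cell contains \<open>t\<close>, and the floor is its
    index.\<close>
  have s_in: "s n t = \<phi> (a + real_of_int \<lfloor>(t - a) * real (Suc n)\<rfloor> / real (Suc n))"
    if t: "a \<le> t" "t < a + real k" for n t
  proof -
    define j where "j = nat \<lfloor>(t - a) * real (Suc n)\<rfloor>"
    have j: "real j = real_of_int \<lfloor>(t - a) * real (Suc n)\<rfloor>"
      using t by (simp add: j_def)
    have A_iff: "t \<in> A n i \<longleftrightarrow> i = j" for i
    proof -
      have "t \<in> A n i \<longleftrightarrow> real i \<le> (t - a) * real (Suc n) \<and> (t - a) * real (Suc n) < real i + 1"
        unfolding A_def by (simp add: field_simps del: of_nat_Suc) (simp add: algebra_simps)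
      also have "\<dots> \<longleftrightarrow> \<lfloor>(t - a) * real (Suc n)\<rfloor> = int i"
        by (simp add: floor_eq_iff)
      also have "\<dots> \<longleftrightarrow> i = j"
        using j by auto
      finally show ?thesis .
    qed
    have "(t - a) * real (Suc n) < real k * real (Suc n)"
      using t by (intro mult_strict_right_mono) auto
    moreover have "real j \<le> (t - a) * real (Suc n)"
      unfolding j by simp
    ultimately have "real j < real (k * Suc n)"
      by (simp only: of_nat_mult)
    then have "j < k * Suc n" by linarith
    moreover have "s n t = (\<Sum>i<k * Suc n. if i = j then \<phi> (a + real i / real (Suc n)) else 0)"
      unfolding s_def by (intro sum.cong) (auto simp: A_iff indicator_def)
    ultimately show ?thesis
      by (simp add: j)
  qed
  have s_out: "s n t = 0" if t: "t \<notin> {a..<a + real k}" for n t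
  proof -
    have "t \<notin> A n i" if "i < k * Suc n" for i
    proof
      assume tA: "t \<in> A n i"
      have "real (Suc i) \<le> real (k * Suc n)" using that by linarith
      then have "real (Suc i) / real (Suc n) \<le> real k"
        by (simp add: field_simps)
      moreover have "0 \<le> real i / real (Suc n)" by simp
      moreover have "a + real i / real (Suc n) \<le> t" "t < a + real (Suc i) / real (Suc n)"
        using tA unfolding A_def atLeastLessThan_iff by auto
      ultimately have "a \<le> t \<and> t < a + real k" by linarith
      then show False using t by simp
    qed
    then show ?thesis unfolding s_def by (intro sum.neutral) auto
  qed
  have lim: "(\<lambda>n. s n t) \<longlonglongrightarrow> F t" if "t \<noteq> a + real k" for t
  proof (cases "a \<le> t \<and> t < a + real k")
    case True
    define x where "x n = a + real_of_int \<lfloor>(t - a) * real (Suc n)\<rfloor> / real (Suc n)" for n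
    have x_le: "x n \<le> t" for n
    proof -
      have "real_of_int \<lfloor>(t - a) * real (Suc n)\<rfloor> \<le> (t - a) * real (Suc n)" by simp
      then have "real_of_int \<lfloor>(t - a) * real (Suc n)\<rfloor> / real (Suc n) \<le> t - a"
        by (subst pos_divide_le_eq) auto
      then show ?thesis by (simp add: x_def)
    qed
    have x_ge: "t - 1 / real (Suc n) \<le> x n" for n
    proof -
      have "(t - a) * real (Suc n) - 1 \<le> real_of_int \<lfloor>(t - a) * real (Suc n)\<rfloor>" by linarith
      then have "((t - a) * real (Suc n) - 1) / real (Suc n) \<le>
          real_of_int \<lfloor>(t - a) * real (Suc n)\<rfloor> / real (Suc n)"
        by (rule divide_right_mono) simp
      then show ?thesis by (simp add: x_def diff_divide_distrib)
    qed
    have "(\<lambda>n. t - 1 / real (Suc n)) \<longlonglongrightarrow> t - 0"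
      using LIMSEQ_inverse_real_of_nat by (intro tendsto_intros) (simp add: divide_inverse)
    then have "x \<longlonglongrightarrow> t"
      using x_le x_ge by (intro real_tendsto_sandwich[of "\<lambda>n. t - 1 / real (Suc n)" x _ "\<lambda>_. t"]) auto
    then have "(\<lambda>n. \<phi> (x n)) \<longlonglongrightarrow> \<phi> t"
      using x_le by (intro continuous_within_tendsto_compose'[OF left]) auto
    then show ?thesis
      using True by (simp add: s_in F_in x_def)
  next
    case False
    then have "t \<notin> {a..a + real k}" "t \<notin> {a..<a + real k}" using that by auto
    then show ?thesis by (simp add: s_out F_out)
  qed
  have AE_ne: "AE t in lebesgue. t \<noteq> a + real k"
    by (rule AE_I'[of "{a + real k}"]) auto
  have lim_AE: "AE t in lebesgue. (\<lambda>n. s n t) \<longlonglongrightarrow> F t"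
    using AE_ne by eventually_elim (rule lim)
  have sm: "strongly_measurable lebesgue F"
    unfolding strongly_measurable_def using s_int lim_AE
    by (intro exI[of _ s]) (auto elim: simple_bochner_integrable.cases)
  have "(\<lambda>n. \<integral>\<^sup>+t. norm (F t - s n t) \<partial>lebesgue) \<longlonglongrightarrow> (\<integral>\<^sup>+(t::real). 0 \<partial>lebesgue)"
  \<comment> \<open>Both \<open>F\<close> and \<open>s n\<close> are bounded by \<open>B\<close> on
    the interval and vanish outside, up to the endpoint \<open>a + real k\<close>, which is a null
    set.\<close>
  proof (rule nn_integral_dominated_convergence[where w="\<lambda>t. ennreal (2 * B) * indicator {a..a + real k} t"])
    show "(\<lambda>x. ennreal (norm (F x - s n x))) \<in> borel_measurable lebesgue" for n
      using strongly_measurable_norm_diff[OF sm, of "s n"] s_int[of n]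
      by (auto elim: simple_bochner_integrable.cases)
    show "AE t in lebesgue. ennreal (norm (F t - s n t)) \<le> ennreal (2 * B) * indicator {a..a + real k} t" for n
      using AE_ne
    proof eventually_elim
      case (elim t)
      show ?case
      proof (cases "a \<le> t \<and> t < a + real k")
        case True
        have "norm (F t - s n t) \<le> norm (F t) + norm (s n t)"
          by (rule norm_triangle_ineq4)
        also have "\<dots> \<le> B + B"
          using True by (simp only: s_in F_in) (intro add_mono bound)
        finally show ?thesis using True by (auto simp: indicator_def intro!: ennreal_leI)
      next
        case False
        then show ?thesis using elim by (auto simp: s_out F_out)
      qed
    qed
    show "(\<lambda>t. ennreal (2 * B) * indicator {a..a + real k} t) \<in> borel_measurable lebesgue"
      by (intro borel_measurable_times_ennreal borel_measurable_const borel_measurable_indicator) auto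
    have "(\<integral>\<^sup>+ t. ennreal (2 * B) * indicator {a..a + real k} t \<partial>lebesgue) = ennreal (2 * B) * ennreal (real k)"
      by (subst nn_integral_cmult_indicator) (auto simp: emeasure_lborel_Icc)
    then show "(\<integral>\<^sup>+ t. ennreal (2 * B) * indicator {a..a + real k} t \<partial>lebesgue) < \<infinity>"
      by (simp add: ennreal_mult_less_top)
    show "AE t in lebesgue. (\<lambda>n. ennreal (norm (F t - s n t))) \<longlonglongrightarrow> 0"
      using lim_AE
    proof eventually_elim
      case (elim t)
      from tendsto_diff[OF tendsto_const elim, of "F t"] have "(\<lambda>n. norm (F t - s n t)) \<longlonglongrightarrow> 0"
        by (intro tendsto_norm_zero) simp
      then show ?case by (subst ennreal_tendsto_0_iff) auto
    qed
  qed auto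
  then have "(\<lambda>n. \<integral>\<^sup>+t. norm (F t - s n t) \<partial>lebesgue) \<longlonglongrightarrow> 0" by simp
  then show ?thesis using that s_int s_val lim_AE by blast
qed

text \<open>The Riemann sums are the integrals of an approximating sequence of step functions. If
  they converge, this sequence witnesses the integral; conversely the integral does not depend on
  the approximating sequence. Both directions serve later: one for existence of a representation,
  the other for uniqueness.\<close>

lemma has_strong_bochner_integral_left_continuous_iff:
  fixes \<phi> F :: "real \<Rightarrow> 'b::real_normed_vector" and a :: real and k :: nat
  assumes "\<And>t. norm (\<phi> t) \<le> B"
    and "\<And>t. continuous (at t within {..t}) \<phi>"
    and "\<And>t. a \<le> t \<Longrightarrow> t < a + real k \<Longrightarrow> F t = \<phi> t"
    and "\<And>t. t \<notin> {a..a + real k} \<Longrightarrow> F t = 0"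
  shows "has_strong_bochner_integral lebesgue F v \<longleftrightarrow>
    (\<lambda>n. (1 / real (Suc n)) *\<^sub>R (\<Sum>i<k * Suc n. \<phi> (a + real i / real (Suc n)))) \<longlonglongrightarrow> v"
proof -
  obtain s where s: "\<And>n. Bochner_Integration.simple_bochner_integrable lebesgue (s n)"
    "\<And>n. Bochner_Integration.simple_bochner_integral lebesgue (s n) =
       (1 / real (Suc n)) *\<^sub>R (\<Sum>i<k * Suc n. \<phi> (a + real i / real (Suc n)))"
    "AE t in lebesgue. (\<lambda>n. s n t) \<longlonglongrightarrow> F t"
    "(\<lambda>n. \<integral>\<^sup>+t. norm (F t - s n t) \<partial>lebesgue) \<longlonglongrightarrow> 0"
    using left_continuous_step_approximation[of \<phi> B a k F] assms by blast
  have "strongly_measurable lebesgue F"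
    unfolding strongly_measurable_def using s(1,3)
    by (intro exI[of _ s]) (auto elim: simple_bochner_integrable.cases)
  then show ?thesis
    using has_strong_bochner_integral_LIMSEQ[of F v s] s(1,4)
    unfolding has_strong_bochner_integral_def s(2)[symmetric] by blast
qed


section \<open>Upper level sets\<close>

lemma upper_level_setI:
  fixes f :: "'a::topological_space \<Rightarrow>\<^sub>C real"
  shows "{x. t \<le> apply_bcontfun f x} \<in> upper_level_sets"
  unfolding upper_level_sets_def by (intro CollectI exI[of _ f] exI[of _ t]) simp

lemma closed_upper_level_set: "A \<in> upper_level_sets \<Longrightarrow> closed A"
  unfolding upper_level_sets_def
  by (auto intro!: closed_Collect_le continuous_on_const continuous_on_apply_bcontfun)

lemma UNIV_upper_level_set: "UNIV \<in> upper_level_sets"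
  and empty_upper_level_set: "{} \<in> upper_level_sets"
  using set_lattice_upper_level_sets unfolding set_lattice_def by auto

lemma vector_capacityD:
  assumes "vector_capacity \<Sigma> \<mu>"
  shows "\<mu> {} = 0" "\<And>A. A \<in> \<Sigma> \<Longrightarrow> 0 \<le> \<mu> A"
    "\<And>A B. A \<in> \<Sigma> \<Longrightarrow> B \<in> \<Sigma> \<Longrightarrow> A \<subseteq> B \<Longrightarrow> \<mu> A \<le> \<mu> B"
  using assms unfolding vector_capacity_def by (auto dest: PiE_mem)

text \<open>Otherwise the closed sets \<open>A n - U\<close> are nonempty and decreasing, and the
  finite intersection property yields a point of every \<open>A n\<close> outside
  \<open>U\<close>.\<close>

lemma decseq_closed_subset_open:
  fixes A :: "nat \<Rightarrow> 'a::topological_space set"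
  assumes cpt: "compact (UNIV :: 'a set)" and cl: "\<And>n. closed (A n)" and dec: "decseq A"
    and U: "open U" "(\<Inter>n. A n) \<subseteq> U"
  shows "\<exists>n. A n \<subseteq> U"
proof (rule ccontr)
  assume "\<not> ?thesis"
  then have ne: "A n - U \<noteq> {}" for n by auto
  have "UNIV \<inter> (\<Inter>n. A n - U) \<noteq> {}"
  proof (rule compact_imp_fip_image[OF cpt])
    fix N :: "nat set" assume N: "finite N"
    \<comment> \<open>Inserting 0 keeps \<open>Max\<close> meaningful when \<open>N\<close> is
      empty.\<close>
    have "A (Max (insert 0 N)) - U \<subseteq> (\<Inter>n\<in>N. A n - U)"
    proof -
      have "A (Max (insert 0 N)) \<subseteq> A n" if "n \<in> N" for n
        using N that by (intro decseqD[OF dec] Max_ge) auto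
      then show ?thesis by blast
    qed
    then show "UNIV \<inter> (\<Inter>n\<in>N. A n - U) \<noteq> {}"
      unfolding Int_UNIV_left using ne by blast
  qed (rule closed_Diff[OF cl U(1)])
  with U(2) show False by auto
qed

text \<open>A compact Hausdorff space is normal; a Urysohn function \<open>g\<close> with value 1 on
  \<open>K\<close> and 0 off \<open>U\<close> gives the set \<open>{x. 1 \<le> g x}\<close>.\<close>

lemma Urysohn_upper_level_set:
  fixes K U :: "'a::t2_space set"
  assumes cpt: "compact (UNIV :: 'a set)" and K: "closed K" and U: "open U" "K \<subseteq> U"
  obtains A where "A \<in> upper_level_sets" "K \<subseteq> A" "A \<subseteq> U"
proof -
  have "Hausdorff_space (euclidean :: 'a topology)"
    unfolding Hausdorff_space_def using hausdorff by (auto simp: disjnt_def)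
  moreover have "compact_space (euclidean :: 'a topology)"
    using cpt by (simp add: compact_space_def)
  ultimately have "normal_space (euclidean :: 'a topology)"
    by (intro compact_Hausdorff_or_regular_imp_normal_space disjI1)
  then obtain g :: "'a \<Rightarrow> real" where g: "continuous_map euclidean euclideanreal g"
    "g ` K \<subseteq> {1}" "g ` (- U) \<subseteq> {0}"
    using K U by (elim Urysohn_lemma_alt[of _ K "- U" 1 0]) (auto simp: disjnt_def)
  have gc: "continuous_on UNIV g" using g(1) by simp
  then have "bounded (range g)"
    using cpt compact_continuous_image compact_imp_bounded by blast
  then have "g \<in> bcontfun" using gc by (simp add: bcontfun_def)
  then obtain f where f: "g = apply_bcontfun f" by (rule bcontfunE)
  show ?thesis
  proof (rule that)
    show "{x. 1 \<le> g x} \<in> upper_level_sets" unfolding f by (rule upper_level_setI)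
  qed (use g in auto)
qed


section \<open>The Choquet-Bochner integral of a continuous function\<close>

text \<open>The level sets at \<open>t - 1 / real (Suc n)\<close> decrease to the level set at
  \<open>t\<close>, so upper continuity controls this one sequence. Monotonicity of the capacity
  extends the control to all levels in between.\<close>

lemma upper_level_left_continuous:
  fixes f :: "'a::topological_space \<Rightarrow>\<^sub>C real" and \<mu> :: "'a set \<Rightarrow> 'e::banach_lattice"
  assumes vc: "vector_capacity upper_level_sets \<mu>" and uc: "upper_continuous upper_level_sets \<mu>"
  shows "continuous (at t within {..t}) (\<lambda>s. \<mu> {x. s \<le> f x})"
  unfolding continuous_within tendsto_iff
proof (intro allI impI)
  fix e :: real assume e: "e > 0"
  define A where "A n = {x. t - 1 / real (Suc n) \<le> f x}" for n
  have lim0: "(\<lambda>n. t - 1 / real (Suc n)) \<longlonglongrightarrow> t - 0"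
    using LIMSEQ_inverse_real_of_nat by (intro tendsto_diff tendsto_const) (simp add: divide_inverse)
  have "x \<in> {x. t \<le> f x}" if x: "x \<in> (\<Inter>n. A n)" for x
  proof -
    have "t - 0 \<le> f x"
      using x by (intro LIMSEQ_le_const2[OF lim0]) (auto simp: A_def)
    then show ?thesis by simp
  qed
  moreover have "x \<in> (\<Inter>n. A n)" if "x \<in> {x. t \<le> f x}" for x
  proof -
    have "t - 1 / real (Suc n) \<le> f x" for n
    proof -
      have "t - 1 / real (Suc n) \<le> t" by simp
      also have "t \<le> f x" using that by simp
      finally show ?thesis .
    qed
    then show ?thesis by (simp add: A_def del: of_nat_Suc)
  qed
  ultimately have Int: "(\<Inter>n. A n) = {x. t \<le> f x}" by blast
  have "decseq A"
    unfolding decseq_def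
  proof (intro allI impI)
    fix m n :: nat assume "m \<le> n"
    then have "1 / real (Suc n) \<le> 1 / real (Suc m)" by (intro divide_left_mono) auto
    then show "A n \<subseteq> A m" by (auto simp: A_def simp del: of_nat_Suc)
  qed
  moreover have "range A \<subseteq> upper_level_sets"
    by (auto simp: A_def upper_level_setI simp del: of_nat_Suc)
  ultimately have "(\<lambda>n. \<mu> (A n)) \<longlonglongrightarrow> \<mu> {x. t \<le> f x}"
    using uc upper_level_setI[of t f] unfolding upper_continuous_def Int[symmetric] by blast
  then obtain n where n: "norm (\<mu> (A n) - \<mu> {x. t \<le> f x}) < e"
    using e unfolding LIMSEQ_iff by blast
  show "\<forall>\<^sub>F s in at t within {..t}. dist (\<mu> {x. s \<le> f x}) (\<mu> {x. t \<le> f x}) < e"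
    unfolding eventually_at
  proof (intro exI conjI ballI impI)
    show "0 < 1 / real (Suc n)" by simp
    fix s assume s: "s \<in> {..t}" "s \<noteq> t \<and> dist s t < 1 / real (Suc n)"
    then have st: "t - 1 / real (Suc n) \<le> s" "s \<le> t"
      unfolding dist_real_def atMost_iff by linarith+
    have "norm (\<mu> {x. s \<le> f x} - \<mu> {x. t \<le> f x}) \<le> norm (\<mu> (A n) - \<mu> {x. t \<le> f x})"
    proof (rule norm_mono_nonneg)
      have "\<mu> {x. t \<le> f x} \<le> \<mu> {x. s \<le> f x}"
        using st by (intro vector_capacityD(3)[OF vc] upper_level_setI) auto
      then show "0 \<le> \<mu> {x. s \<le> f x} - \<mu> {x. t \<le> f x}" by simp
      have "\<mu> {x. s \<le> f x} \<le> \<mu> (A n)"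
        using st unfolding A_def by (intro vector_capacityD(3)[OF vc] upper_level_setI) auto
      then show "\<mu> {x. s \<le> f x} - \<mu> {x. t \<le> f x} \<le> \<mu> (A n) - \<mu> {x. t \<le> f x}" by simp
    qed
    then show "dist (\<mu> {x. s \<le> f x}) (\<mu> {x. t \<le> f x}) < e"
      using n by (simp add: dist_norm)
  qed
qed

text \<open>Since \<open>f\<close> takes values between \<open>- real k\<close> and
  \<open>real k\<close>, the two integrands vanish outside \<open>{0..real k}\<close> and
  \<open>{- real k..0}\<close>. Each integral is therefore a limit of left Riemann sums. The summand
  \<open>0 +\<close> keeps the first sum in the same shape as the second, with starting point
  \<open>a = 0\<close>.\<close>

lemma has_choquet_bochner_integral_iff_LIMSEQ:
  fixes f :: "'a::topological_space \<Rightarrow>\<^sub>C real" and \<mu> :: "'a set \<Rightarrow> 'e::banach_lattice"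
  assumes vc: "vector_capacity upper_level_sets \<mu>" and uc: "upper_continuous upper_level_sets \<mu>"
    and bound: "\<And>x. \<bar>f x\<bar> \<le> real k"
  shows "has_choquet_bochner_integral \<mu> f v \<longleftrightarrow>
    (\<exists>a b. (\<lambda>n. (1 / real (Suc n)) *\<^sub>R (\<Sum>i<k * Suc n. \<mu> {x. 0 + real i / real (Suc n) \<le> f x})) \<longlonglongrightarrow> a \<and>
       (\<lambda>n. (1 / real (Suc n)) *\<^sub>R
          (\<Sum>i<k * Suc n. \<mu> {x. - real k + real i / real (Suc n) \<le> f x} - \<mu> UNIV)) \<longlonglongrightarrow> b \<and>
       v = a + b)"
proof -
  let ?\<phi> = "\<lambda>t. \<mu> {x. t \<le> f x}"
  have le_UNIV: "?\<phi> t \<le> \<mu> UNIV" for t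
    by (intro vector_capacityD(3)[OF vc] upper_level_setI UNIV_upper_level_set) auto
  have nn: "0 \<le> ?\<phi> t" for t
    by (intro vector_capacityD(2)[OF vc] upper_level_setI)
  have norm: "norm (?\<phi> t) \<le> norm (\<mu> UNIV)" for t
    by (intro norm_mono_nonneg le_UNIV nn)
  have norm': "norm (?\<phi> t - \<mu> UNIV) \<le> norm (\<mu> UNIV) + norm (\<mu> UNIV)" for t
    by (rule norm_triangle_le_diff) (simp add: norm)
  have empty: "?\<phi> t = 0" if "real k < t" for t
  proof -
    have "\<not> t \<le> f x" for x using bound[of x] that by linarith
    then have "{x. t \<le> f x} = {}" by auto
    then show ?thesis using vector_capacityD(1)[OF vc] by simp
  qed
  have full: "?\<phi> t = \<mu> UNIV" if "t < - real k" for t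
  proof -
    have "t \<le> f x" for x using bound[of x] that by linarith
    then have "{x. t \<le> f x} = UNIV" by auto
    then show ?thesis by simp
  qed
  note left = upper_level_left_continuous[OF vc uc, of _ f]
  have pos: "has_strong_bochner_integral lebesgue (\<lambda>t::real. indicator {0..} t *\<^sub>R ?\<phi> t) a \<longleftrightarrow>
    (\<lambda>n. (1 / real (Suc n)) *\<^sub>R (\<Sum>i<k * Suc n. ?\<phi> (0 + real i / real (Suc n)))) \<longlonglongrightarrow> a" for a
  proof (rule has_strong_bochner_integral_left_continuous_iff[OF norm left])
    show "indicator {0..} t *\<^sub>R ?\<phi> t = 0" if "t \<notin> {0..0 + real k}" for t
      using that empty[of t] by (auto simp: indicator_def)
  qed simp
  \<comment> \<open>At the right endpoint 0 the indicator \<open>{..0}\<close> is still 1; the value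
    there is unconstrained in the Riemann sum criterion.\<close>
  have neg: "has_strong_bochner_integral lebesgue (\<lambda>t::real. indicator {..0} t *\<^sub>R (?\<phi> t - \<mu> UNIV)) b \<longleftrightarrow>
    (\<lambda>n. (1 / real (Suc n)) *\<^sub>R (\<Sum>i<k * Suc n. ?\<phi> (- real k + real i / real (Suc n)) - \<mu> UNIV)) \<longlonglongrightarrow> b" for b
  proof (rule has_strong_bochner_integral_left_continuous_iff[OF norm'])
    show "continuous (at t within {..t}) (\<lambda>t. ?\<phi> t - \<mu> UNIV)" for t
      by (intro continuous_diff left continuous_const)
    show "indicator {..0} t *\<^sub>R (?\<phi> t - \<mu> UNIV) = 0" if "t \<notin> {- real k..- real k + real k}" for t
      using that full[of t] by (auto simp: indicator_def)
  qed simp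
  show ?thesis
    unfolding has_choquet_bochner_integral_def pos neg ..
qed


section \<open>Comonotonic additive monotone operators\<close>

locale comonotonic_operator =
  fixes I :: "('a::t2_space \<Rightarrow>\<^sub>C real) \<Rightarrow> 'e::banach_lattice"
  assumes compact_UNIV: "compact (UNIV :: 'a set)"
    and order_continuous: "order_continuous_norm TYPE('e)"
    and additive: "comonotonic_additive I"
    and monotone: "monotone_operator I"
begin

text \<open>The value \<open>J h\<close> is meaningful only for continuous \<open>h\<close>.\<close>

definition J :: "('a \<Rightarrow> real) \<Rightarrow> 'e" where
  "J h = I (Bcontfun h)"

lemma apply_Bcontfun:
  assumes "continuous_on UNIV h"
  shows "apply_bcontfun (Bcontfun h :: 'a \<Rightarrow>\<^sub>C real) = h"
proof -
  have "bounded (range h)"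
    using assms compact_UNIV compact_continuous_image compact_imp_bounded by blast
  then show ?thesis
    using assms by (intro Bcontfun_inverse) (simp add: bcontfun_def)
qed

lemma J_apply_bcontfun: "J (apply_bcontfun f) = I f"
  by (simp add: J_def apply_bcontfun_inverse)

lemma J_mono:
  assumes "continuous_on UNIV f" "continuous_on UNIV g" "\<And>x. f x \<le> g x"
  shows "J f \<le> J g"
  using monotone assms unfolding monotone_operator_def J_def by (simp add: apply_Bcontfun)

lemma J_add:
  assumes fg: "continuous_on UNIV f" "continuous_on UNIV g" and co: "comonotone f g"
  shows "J (\<lambda>x. f x + g x) = J f + J g"
proof -
  have "Bcontfun (\<lambda>x. f x + g x) = (Bcontfun f + Bcontfun g :: 'a \<Rightarrow>\<^sub>C real)"
    using fg by (intro bcontfun_eqI) (simp add: apply_Bcontfun continuous_on_add plus_bcontfun.rep_eq)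
  then show ?thesis
    using additive fg co unfolding comonotonic_additive_def J_def by (simp add: apply_Bcontfun)
qed

lemma J_zero: "J (\<lambda>_. 0) = 0"
  using J_add[of "\<lambda>_. 0" "\<lambda>_. 0"] by (simp add: comonotone_def)

lemma J_nonneg: "continuous_on UNIV f \<Longrightarrow> (\<And>x. 0 \<le> f x) \<Longrightarrow> 0 \<le> J f"
  using J_mono[of "\<lambda>_. 0" f] by (simp add: J_zero)

lemma J_add_const: "continuous_on UNIV f \<Longrightarrow> J (\<lambda>x. f x + c) = J f + J (\<lambda>_. c)"
  by (intro J_add) (auto simp: comonotone_def)

text \<open>A function is comonotone with its nonnegative multiples, so each induction step is one
  use of additivity. Natural factors suffice because every mesh below is the reciprocal of a natural
  number.\<close>

lemma J_of_nat_mult: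
  assumes "continuous_on UNIV f"
  shows "J (\<lambda>x. real n * f x) = real n *\<^sub>R J f"
proof (induction n)
  case (Suc n)
  have "comonotone f (\<lambda>x. real n * f x)"
    unfolding comonotone_def by (auto simp flip: right_diff_distrib intro: mult_nonneg_nonneg simp: mult.left_commute)
  then have "J (\<lambda>x. f x + real n * f x) = J f + J (\<lambda>x. real n * f x)"
    using assms by (intro J_add) (auto intro!: continuous_intros)
  then show ?case
    using Suc by (simp add: algebra_simps)
qed (simp add: J_zero)

lemma J_const_of_nat: "J (\<lambda>_. real n) = real n *\<^sub>R J (\<lambda>_. 1)"
  using J_of_nat_mult[of "\<lambda>_. 1" n] by simp

lemma J_const_inverse: "J (\<lambda>_. 1 / real (Suc n)) = (1 / real (Suc n)) *\<^sub>R J (\<lambda>_. 1)"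
proof -
  have "J (\<lambda>_. 1) = real (Suc n) *\<^sub>R J (\<lambda>_. 1 / real (Suc n))"
    using J_of_nat_mult[of "\<lambda>_. 1 / real (Suc n)" "Suc n"] by (simp del: of_nat_Suc)
  then show ?thesis by (simp del: of_nat_Suc)
qed

section \<open>The capacity generated by continuous majorants\<close>

definition majorants :: "'a set \<Rightarrow> ('a \<Rightarrow> real) set" where
  "majorants A = {h. continuous_on UNIV h \<and> (\<forall>x. indicator A x \<le> h x)}"

definition cap :: "'a set \<Rightarrow> 'e" where
  "cap A = (THE v. isGlb UNIV (J ` majorants A) v)"

lemma majorantsD:
  assumes "h \<in> majorants A"
  shows "continuous_on UNIV h" "\<And>x. indicator A x \<le> h x" "\<And>x. 0 \<le> h x" "\<And>x. x \<in> A \<Longrightarrow> 1 \<le> h x"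
proof -
  show 1: "continuous_on UNIV h" "\<And>x. indicator A x \<le> h x"
    using assms by (auto simp: majorants_def)
  show "0 \<le> h x" for x using 1(2)[of x] by (cases "x \<in> A") auto
  show "1 \<le> h x" if "x \<in> A" for x using 1(2)[of x] that by simp
qed

lemma majorantsI:
  "continuous_on UNIV h \<Longrightarrow> (\<And>x. 0 \<le> h x) \<Longrightarrow> (\<And>x. x \<in> A \<Longrightarrow> 1 \<le> h x) \<Longrightarrow> h \<in> majorants A"
  by (auto simp: majorants_def indicator_def)

text \<open>The pointwise minimum of two majorants is a majorant, so their values under
  \<open>J\<close> are downward directed, with lower bound 0. This justifies the description in
  \<open>cap\<close>.\<close>

lemma isGlb_cap: "isGlb UNIV (J ` majorants A) (cap A)"
proof -
  have "\<exists>v. isGlb UNIV (J ` majorants A) v"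
  proof (rule downward_directed_isGlb[OF order_continuous])
    have "(\<lambda>_. 1) \<in> majorants A" by (intro majorantsI) auto
    then show "J ` majorants A \<noteq> {}" by blast
    show "0 \<le> u" if "u \<in> J ` majorants A" for u
      using that by (auto intro: J_nonneg dest: majorantsD)
    fix u v assume "u \<in> J ` majorants A" "v \<in> J ` majorants A"
    then obtain f g where fg: "f \<in> majorants A" "g \<in> majorants A" "u = J f" "v = J g" by blast
    have m: "(\<lambda>x. min (f x) (g x)) \<in> majorants A"
      using fg by (intro majorantsI) (auto dest: majorantsD intro!: continuous_intros)
    show "\<exists>w\<in>J ` majorants A. w \<le> u \<and> w \<le> v"
      using fg m by (intro bexI[of _ "J (\<lambda>x. min (f x) (g x))"] conjI imageI)
        (auto intro!: J_mono dest: majorantsD)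
  qed
  then obtain v where v: "isGlb UNIV (J ` majorants A) v" by blast
  show ?thesis
    unfolding cap_def by (rule theI[of "isGlb UNIV (J ` majorants A)" v, OF v isGlb_unique_order[OF _ v]])
qed

lemma cap_le: "h \<in> majorants A \<Longrightarrow> cap A \<le> J h"
  using isGlb_cap[of A] by (auto simp: isGlb_UNIV_iff)

lemma cap_greatest: "(\<And>h. h \<in> majorants A \<Longrightarrow> z \<le> J h) \<Longrightarrow> z \<le> cap A"
  using isGlb_cap[of A] by (auto simp: isGlb_UNIV_iff)

lemma cap_mono: "A \<subseteq> B \<Longrightarrow> cap A \<le> cap B"
  by (intro cap_greatest cap_le majorantsI) (auto intro: majorantsD(1,3,4))

text \<open>A continuous function below the indicator is below every majorant. Together with
  \<open>cap_le\<close> this allows \<open>J\<close> to be compared with \<open>cap\<close> from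
  both sides.\<close>

lemma J_le_cap:
  assumes "continuous_on UNIV h" "\<And>x. h x \<le> indicator A x"
  shows "J h \<le> cap A"
proof (rule cap_greatest)
  fix g assume g: "g \<in> majorants A"
  show "J h \<le> J g"
    using assms majorantsD(1,2)[OF g] by (intro J_mono) (auto intro: order_trans)
qed

lemma cap_nonneg: "0 \<le> cap A"
  using J_le_cap[of "\<lambda>_. 0" A] by (simp add: J_zero)

lemma cap_empty: "cap {} = 0"
  using cap_le[of "\<lambda>_. 0" "{}"] cap_nonneg[of "{}"] by (simp add: J_zero majorants_def)

lemma cap_UNIV: "cap UNIV = J (\<lambda>_. 1)"
  by (intro order_antisym cap_le J_le_cap majorantsI) auto

text \<open>Where \<open>h\<close> exceeds \<open>1 - 1 / real (Suc n)\<close>, adding the constant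
  \<open>1 / real (Suc n)\<close> lifts it above 1, so the lifted function majorizes an open
  neighbourhood of \<open>A\<close>. Constants are comonotone with everything, so the lift costs
  exactly \<open>(1 / real (Suc n)) *\<^sub>R J (\<lambda>_. 1)\<close>.\<close>

lemma cap_open_neighbourhood:
  assumes h: "h \<in> majorants A"
  obtains U where "open U" "A \<subseteq> U" "cap U \<le> J h + (1 / real (Suc n)) *\<^sub>R J (\<lambda>_. 1)"
proof -
  define U where "U = {x. 1 - 1 / real (Suc n) < h x}"
  note hD = majorantsD[OF h]
  have "open U"
    unfolding U_def by (intro open_Collect_less continuous_on_const hD)
  moreover have "A \<subseteq> U"
  proof
    fix x assume "x \<in> A"
    have "1 - 1 / real (Suc n) < 1" by simp
    also have "1 \<le> h x" using \<open>x \<in> A\<close> by (rule hD(4))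
    finally show "x \<in> U" by (simp add: U_def)
  qed
  moreover have "cap U \<le> J (\<lambda>x. h x + 1 / real (Suc n))"
    using hD by (intro cap_le majorantsI) (auto simp: U_def simp del: of_nat_Suc intro!: continuous_intros add_nonneg_nonneg)
  then have "cap U \<le> J h + (1 / real (Suc n)) *\<^sub>R J (\<lambda>_. 1)"
    by (simp only: J_add_const[OF hD(1)] J_const_inverse)
  ultimately show ?thesis by (rule that)
qed

text \<open>The decreasing values have a limit \<open>L\<close>. A majorant of the intersection
  almost majorizes an open neighbourhood of it, and by compactness some \<open>A N\<close> already
  lies inside; hence \<open>L\<close> is at most the value of every majorant.\<close>

lemma cap_continuous:
  assumes cl: "\<And>n. closed (A n)" and dec: "decseq A"
  shows "(\<lambda>n. cap (A n)) \<longlonglongrightarrow> cap (\<Inter>n. A n)"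
proof -
  have "decseq (\<lambda>n. cap (A n))"
    using dec by (auto simp: decseq_def intro: cap_mono)
  moreover have "cap (\<Inter>n. A n) \<le> cap (A n)" for n
    by (intro cap_mono) auto
  ultimately obtain L where L: "(\<lambda>n. cap (A n)) \<longlonglongrightarrow> L" "\<And>n. L \<le> cap (A n)" "cap (\<Inter>n. A n) \<le> L"
    using decseq_bounded_convergent[OF order_continuous, of "\<lambda>n. cap (A n)" "cap (\<Inter>n. A n)"] by metis
  have "L \<le> cap (\<Inter>n. A n)"
  proof (rule cap_greatest)
    fix h assume h: "h \<in> majorants (\<Inter>n. A n)"
    show "L \<le> J h"
    proof (rule le_archimedean)
      fix n
      obtain U where U: "open U" "(\<Inter>n. A n) \<subseteq> U" "cap U \<le> J h + (1 / real (Suc n)) *\<^sub>R J (\<lambda>_. 1)"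
        using cap_open_neighbourhood[OF h] .
      obtain N where "A N \<subseteq> U"
        using decseq_closed_subset_open[OF compact_UNIV cl dec U(1,2)] by blast
      then have "cap (A N) \<le> cap U" by (rule cap_mono)
      then show "L \<le> J h + (1 / real (Suc n)) *\<^sub>R J (\<lambda>_. 1)"
        using L(2)[of N] U(3) by (blast intro: order_trans)
    qed
  qed
  then show ?thesis using L by (metis order_antisym)
qed

section \<open>Representation of the operator on the upper level sets\<close>

definition level_cap :: "'a set \<Rightarrow> 'e" where
  "level_cap = restrict cap upper_level_sets"

lemma vector_capacity_level_cap: "vector_capacity upper_level_sets level_cap"
  unfolding vector_capacity_def level_cap_def
  using cap_nonneg cap_mono
  by (auto simp: set_lattice_upper_level_sets cap_empty empty_upper_level_set)

lemma upper_continuous_level_cap: "upper_continuous upper_level_sets level_cap"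
  unfolding upper_continuous_def
proof (intro allI impI)
  fix A :: "nat \<Rightarrow> 'a set"
  assume A: "range A \<subseteq> upper_level_sets \<and> decseq A \<and> (\<Inter>n. A n) \<in> upper_level_sets"
  then have "(\<lambda>n. cap (A n)) \<longlonglongrightarrow> cap (\<Inter>n. A n)"
    by (intro cap_continuous closed_upper_level_set) auto
  moreover have "A n \<in> upper_level_sets" for n using A by blast
  ultimately show "(\<lambda>n. level_cap (A n)) \<longlonglongrightarrow> level_cap (\<Inter>n. A n)"
    using A by (simp add: level_cap_def)
qed

text \<open>The limit is \<open>J\<close> of the part of \<open>f\<close> between the heights
  \<open>a\<close> and \<open>a + real k\<close>. Multiplied by \<open>m\<close>, the layer
  \<open>d i\<close> lies between the indicators of the level sets with indices \<open>Suc i\<close>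
  and \<open>i\<close>, which gives
  \<open>\<phi> (Suc i) \<le> m *\<^sub>R J (d i) \<le> \<phi> i\<close>; summing over the layers
  traps the limit.\<close>

lemma riemann_sum_cap_LIMSEQ:
  fixes f :: "'a \<Rightarrow> real" and a :: real and k :: nat
  assumes f: "continuous_on UNIV f"
  shows "(\<lambda>n. (1 / real (Suc n)) *\<^sub>R (\<Sum>i<k * Suc n. cap {x. a + real i / real (Suc n) \<le> f x}))
    \<longlonglongrightarrow> J (\<lambda>x. min (max (f x - a) 0) (real k))"
proof -
  let ?R = "\<lambda>n. (1 / real (Suc n)) *\<^sub>R (\<Sum>i<k * Suc n. cap {x. a + real i / real (Suc n) \<le> f x})"
  let ?c = "J (\<lambda>x. min (max (f x - a) 0) (real k))"
  have bounds: "?c \<le> ?R n \<and> ?R n \<le> ?c + (1 / real (Suc n)) *\<^sub>R cap UNIV" for n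
  proof -
    define m where "m = real (Suc n)"
    have m: "m > 0" by (simp add: m_def)
    define \<phi> where "\<phi> i = cap {x. a + real i / m \<le> f x}" for i :: nat
    define d where "d i x = min (max (f x - a - real i / m) 0) (1 / m)" for i :: nat and x
    define c where "c i x = min (max (f x - a) 0) (real i / m)" for i :: nat and x
    have d_cont: "continuous_on UNIV (d i)" and c_cont: "continuous_on UNIV (c i)" for i
      unfolding d_def c_def using f by (auto intro!: continuous_intros)
    \<comment> \<open>Truncation at height \<open>p + q\<close> is truncation at \<open>p\<close>
      plus the excess over \<open>p\<close> truncated at \<open>q\<close>. With
      \<open>p = real i / m\<close> and \<open>q = 1 / m\<close> this peels the layer
      \<open>d i\<close> off \<open>c (Suc i)\<close>.\<close>
    have split: "min (max z 0) (p + q) = min (max z 0) p + min (max (z - p) 0) q"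
      if "0 \<le> p" "0 \<le> q" for p q z :: real
      using that by (auto simp: min_def max_def)
    have c_Suc: "c (Suc i) = (\<lambda>x. c i x + d i x)" for i
    proof
      fix x
      have pq: "0 \<le> real i / m" "0 \<le> 1 / m" using m by auto
      have "real (Suc i) / m = real i / m + 1 / m"
        by (simp add: add_divide_distrib)
      then show "c (Suc i) x = c i x + d i x"
        unfolding c_def d_def by (simp only: split[OF pq])
    qed
    \<comment> \<open>Both functions are nondecreasing functions of \<open>f\<close>.\<close>
    have co: "comonotone (c i) (d i)" for i
      unfolding comonotone_def
    proof (intro allI)
      fix s t
      have *: "c i s \<le> c i t \<and> d i s \<le> d i t" if "f s \<le> f t" for s t
        unfolding c_def d_def using that by (intro conjI min.mono max.mono) auto
      show "0 \<le> (c i s - c i t) * (d i s - d i t)"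
      proof (cases "f s \<le> f t")
        case True
        with *[of s t] show ?thesis by (intro mult_nonpos_nonpos) auto
      next
        case False
        with *[of t s] show ?thesis by (intro mult_nonneg_nonneg) auto
      qed
    qed
    have c_sum: "J (c N) = (\<Sum>i<N. J (d i))" for N
    proof (induction N)
      case 0
      have "c 0 = (\<lambda>_. 0)" by (auto simp: c_def)
      then show ?case by (simp add: J_zero)
    next
      case (Suc N)
      then show ?case by (simp add: c_Suc J_add[OF c_cont d_cont co])
    qed
    have md: "J (\<lambda>x. m * d i x) = m *\<^sub>R J (d i)" for i
      unfolding m_def by (rule J_of_nat_mult[OF d_cont])
    have md_cont: "continuous_on UNIV (\<lambda>x. m * d i x)" for i
      by (intro continuous_intros d_cont)
    have up: "m *\<^sub>R J (d i) \<le> \<phi> i" for i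
      unfolding md[symmetric] \<phi>_def
    proof (rule J_le_cap[OF md_cont])
      fix x
      have "d i x \<le> 1 / m" by (simp add: d_def)
      then have "m * d i x \<le> 1" using m by (simp add: field_simps)
      moreover have "d i x = 0" if "\<not> a + real i / m \<le> f x"
        using that m by (auto simp: d_def)
      ultimately show "m * d i x \<le> indicator {x. a + real i / m \<le> f x} x"
        by (auto simp: indicator_def)
    qed
    have low: "\<phi> (Suc i) \<le> m *\<^sub>R J (d i)" for i
      unfolding md[symmetric] \<phi>_def
    proof (rule cap_le, rule majorantsI[OF md_cont])
      show "0 \<le> m * d i x" for x using m by (simp add: d_def)
      fix x assume "x \<in> {x. a + real (Suc i) / m \<le> f x}"
      moreover have "real (Suc i) / m = real i / m + 1 / m"
        by (simp add: add_divide_distrib)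
      ultimately have "1 / m \<le> f x - a - real i / m" by (auto simp del: of_nat_Suc)
      then have "1 / m \<le> d i x" by (simp add: d_def)
      then show "1 \<le> m * d i x" using m by (simp add: field_simps)
    qed
    have up': "J (d i) \<le> (1 / m) *\<^sub>R \<phi> i" and low': "(1 / m) *\<^sub>R \<phi> (Suc i) \<le> J (d i)" for i
      using scaleR_left_mono[OF up[of i], of "1 / m"] scaleR_left_mono[OF low[of i], of "1 / m"] m
      by simp_all
    have "real (k * Suc n) / m = real k"
      by (simp only: m_def of_nat_mult) simp
    then have c_top: "J (c (k * Suc n)) = ?c" by (simp add: c_def[abs_def])
    have R: "?R n = (1 / m) *\<^sub>R (\<Sum>i<k * Suc n. \<phi> i)" by (simp add: \<phi>_def m_def)
    have "J (c (k * Suc n)) \<le> ?R n"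
      unfolding R c_sum unfolding scaleR_sum_right by (intro sum_mono up')
    moreover have "?R n \<le> J (c (k * Suc n)) + (1 / m) *\<^sub>R cap UNIV"
    proof -
      have "(1 / m) *\<^sub>R (\<Sum>i<k * Suc n. \<phi> (Suc i)) \<le> J (c (k * Suc n))"
        unfolding c_sum scaleR_sum_right by (intro sum_mono low')
      \<comment> \<open>Upper and lower sum differ only in their first and last terms, so after
        scaling by \<open>1 / m\<close> the gap is at most
        \<open>(1 / m) *\<^sub>R cap UNIV\<close>.\<close>
      moreover have "(\<Sum>i<k * Suc n. \<phi> i) - (\<Sum>i<k * Suc n. \<phi> (Suc i)) = \<phi> 0 - \<phi> (k * Suc n)"
        unfolding sum_subtractf[symmetric] by (rule sum_lessThan_telescope')
      then have "(\<Sum>i<k * Suc n. \<phi> i) = (\<Sum>i<k * Suc n. \<phi> (Suc i)) + (\<phi> 0 - \<phi> (k * Suc n))"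
        by (simp add: algebra_simps)
      then have "?R n = (1 / m) *\<^sub>R (\<Sum>i<k * Suc n. \<phi> (Suc i)) + (1 / m) *\<^sub>R (\<phi> 0 - \<phi> (k * Suc n))"
        unfolding R by (simp only: scaleR_add_right)
      moreover have "\<phi> 0 - \<phi> (k * Suc n) \<le> cap UNIV - 0"
        unfolding \<phi>_def by (intro diff_mono cap_mono cap_nonneg) auto
      then have "(1 / m) *\<^sub>R (\<phi> 0 - \<phi> (k * Suc n)) \<le> (1 / m) *\<^sub>R cap UNIV"
        using m by (intro scaleR_left_mono) auto
      ultimately show ?thesis by (simp only: add_mono)
    qed
    ultimately show ?thesis by (simp only: c_top m_def simp_thms)
  qed
  have "(\<lambda>n. ?c + (1 / real (Suc n)) *\<^sub>R cap UNIV) \<longlonglongrightarrow> ?c + 0 *\<^sub>R cap UNIV"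
    using LIMSEQ_inverse_real_of_nat
    by (intro tendsto_add tendsto_scaleR tendsto_const) (simp add: divide_inverse)
  then have lim: "(\<lambda>n. ?c + (1 / real (Suc n)) *\<^sub>R cap UNIV) \<longlonglongrightarrow> ?c"
    by (simp only: scaleR_zero_left add_0_right)
  show ?thesis
    by (rule order_squeeze[OF tendsto_const lim conjunct1[OF bounds] conjunct2[OF bounds]])
qed

lemma represents_level_cap: "represents level_cap I"
  unfolding represents_def
proof
  fix f :: "'a \<Rightarrow>\<^sub>C real"
  obtain b where "\<And>x. \<bar>f x\<bar> \<le> b"
    using bounded_apply_bcontfun[of f] unfolding bounded_iff by auto
  moreover obtain k :: nat where "b \<le> real k" using real_arch_simple by blast
  ultimately have k: "\<bar>f x\<bar> \<le> real k" for x by (meson order_trans)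
  have f: "continuous_on UNIV f" by simp
  \<comment> \<open>Because the absolute value of \<open>f\<close> is at most \<open>real k\<close>,
    \<open>?p\<close> is the positive part of \<open>f\<close> and \<open>?q\<close> is
    \<open>real k\<close> minus the negative part. Both increase with \<open>f\<close>, and their
    sum is \<open>f + real k\<close>.\<close>
  let ?p = "\<lambda>x. min (max (f x - 0) 0) (real k)" and ?q = "\<lambda>x. min (max (f x - - real k) 0) (real k)"
  have p: "continuous_on UNIV ?p" and q: "continuous_on UNIV ?q"
    by (auto intro!: continuous_intros)
  have eq: "?p x + ?q x = f x + real k" for x
    using k[of x] by (auto simp: min_def max_def)
  have "comonotone ?p ?q"
    unfolding comonotone_def
  proof (intro allI)
    fix s t
    have *: "?p s \<le> ?p t \<and> ?q s \<le> ?q t" if "f s \<le> f t" for s t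
      using that by (auto simp: min_def max_def)
    show "0 \<le> (?p s - ?p t) * (?q s - ?q t)"
    proof (cases "f s \<le> f t")
      case True
      with *[of s t] show ?thesis by (intro mult_nonpos_nonpos) auto
    next
      case False
      with *[of t s] show ?thesis by (intro mult_nonneg_nonneg) auto
    qed
  qed
  from J_add[OF p q this] have "J ?p + J ?q = I f + real k *\<^sub>R J (\<lambda>_. 1)"
    unfolding eq J_add_const[OF f] J_const_of_nat J_apply_bcontfun by simp
  then have v: "I f = J ?p + (J ?q - real k *\<^sub>R cap UNIV)"
    by (simp add: cap_UNIV algebra_simps)
  have lv: "level_cap {x. t \<le> f x} = cap {x. t \<le> f x}" for t
    by (simp add: level_cap_def upper_level_setI)
  have lU: "level_cap UNIV = cap UNIV"
    by (simp add: level_cap_def UNIV_upper_level_set)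
  have "(\<lambda>n. (1 / real (Suc n)) *\<^sub>R (\<Sum>i<k * Suc n. cap {x. - real k + real i / real (Suc n) \<le> f x})
      - real k *\<^sub>R cap UNIV) \<longlonglongrightarrow> J ?q - real k *\<^sub>R cap UNIV"
    by (intro tendsto_diff tendsto_const riemann_sum_cap_LIMSEQ f)
  \<comment> \<open>Spread over \<open>k * Suc n\<close> terms of weight
    \<open>1 / real (Suc n)\<close>, the correction \<open>real k *\<^sub>R cap UNIV\<close> becomes
    one \<open>cap UNIV\<close> per term, as in the integral over the negative half-line.\<close>
  moreover have "(1 / real (Suc n)) *\<^sub>R (\<Sum>i<k * Suc n. cap {x. - real k + real i / real (Suc n) \<le> f x})
      - real k *\<^sub>R cap UNIV =
    (1 / real (Suc n)) *\<^sub>R (\<Sum>i<k * Suc n. cap {x. - real k + real i / real (Suc n) \<le> f x} - cap UNIV)" for n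
  proof -
    have "(1 / real (Suc n)) *\<^sub>R (\<Sum>i<k * Suc n. cap UNIV) = real k *\<^sub>R cap UNIV"
      by (simp only: sum_constant_scaleR card_lessThan scaleR_scaleR of_nat_mult) simp
    then show ?thesis unfolding sum_subtractf scaleR_diff_right by simp
  qed
  ultimately have "(\<lambda>n. (1 / real (Suc n)) *\<^sub>R
      (\<Sum>i<k * Suc n. cap {x. - real k + real i / real (Suc n) \<le> f x} - cap UNIV)) \<longlonglongrightarrow>
      J ?q - real k *\<^sub>R cap UNIV" by (simp only:)
  then show "has_choquet_bochner_integral level_cap f (I f)"
    unfolding has_choquet_bochner_integral_iff_LIMSEQ[OF vector_capacity_level_cap upper_continuous_level_cap k]
      lv lU
    using v riemann_sum_cap_LIMSEQ[OF f, where a = 0 and k = k] by blast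
qed

section \<open>Uniqueness of the representing capacity\<close>

lemma representing_capacity_riemann:
  assumes vc: "vector_capacity upper_level_sets \<mu>" and uc: "upper_continuous upper_level_sets \<mu>"
    and rep: "represents \<mu> I" and g: "continuous_on UNIV g" "\<And>x. 0 \<le> g x" "\<And>x. g x \<le> 1"
  shows "(\<lambda>n. (1 / real (Suc n)) *\<^sub>R (\<Sum>i<Suc n. \<mu> {x. real i / real (Suc n) \<le> g x})) \<longlonglongrightarrow> J g"
proof -
  define f :: "'a \<Rightarrow>\<^sub>C real" where "f = Bcontfun g"
  have fg: "apply_bcontfun f = g" unfolding f_def by (rule apply_Bcontfun[OF g(1)])
  have bound: "\<bar>f x\<bar> \<le> real 1" for x using g(2,3)[of x] by (simp add: fg)
  have "has_choquet_bochner_integral \<mu> f (J g)"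
    using rep unfolding represents_def by (simp add: J_def f_def)
  then obtain a b where
    a: "(\<lambda>n. (1 / real (Suc n)) *\<^sub>R (\<Sum>i<1 * Suc n. \<mu> {x. 0 + real i / real (Suc n) \<le> f x})) \<longlonglongrightarrow> a"
    and b: "(\<lambda>n. (1 / real (Suc n)) *\<^sub>R
          (\<Sum>i<1 * Suc n. \<mu> {x. - real 1 + real i / real (Suc n) \<le> f x} - \<mu> UNIV)) \<longlonglongrightarrow> b"
    and ab: "J g = a + b"
    unfolding has_choquet_bochner_integral_iff_LIMSEQ[OF vc uc bound] by (elim exE conjE)
  \<comment> \<open>All levels sampled for the second integral are at most 0, hence below
    \<open>g\<close>; each of its terms is \<open>\<mu> UNIV - \<mu> UNIV\<close>.\<close>
  have "{x. - real 1 + real i / real (Suc n) \<le> f x} = UNIV" if "i < 1 * Suc n" for i n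
  proof -
    have "real i / real (Suc n) \<le> 1" using that by simp
    then have "- real 1 + real i / real (Suc n) \<le> f x" for x
      using g(2)[of x] unfolding fg by linarith
    then show ?thesis by auto
  qed
  then have "(1 / real (Suc n)) *\<^sub>R
      (\<Sum>i<1 * Suc n. \<mu> {x. - real 1 + real i / real (Suc n) \<le> f x} - \<mu> UNIV) = 0" for n
    by (simp del: of_nat_Suc mult_1)
  then have "b = 0" using b by (simp add: LIMSEQ_const_iff)
  then show ?thesis using a ab by (simp add: fg)
qed

text \<open>Every sampled level is at most 1, so its level set contains \<open>A\<close>. Each
  Riemann sum is thus an average of values above \<open>\<mu> A\<close>.\<close>

lemma representing_capacity_le_J:
  assumes "vector_capacity upper_level_sets \<mu>" "upper_continuous upper_level_sets \<mu>" "represents \<mu> I"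
    and g: "continuous_on UNIV g" "\<And>x. 0 \<le> g x" "\<And>x. g x \<le> 1"
    and A: "A \<in> upper_level_sets" "\<And>x. x \<in> A \<Longrightarrow> g x = 1"
  shows "\<mu> A \<le> J g"
proof (rule limit_mono[OF tendsto_const representing_capacity_riemann[OF assms(1-6)]])
  fix n
  have level: "{x. t \<le> g x} \<in> upper_level_sets" for t
    using upper_level_setI[of t "Bcontfun g"] by (simp add: apply_Bcontfun g)
  have "(\<Sum>i<Suc n. \<mu> A) \<le> (\<Sum>i<Suc n. \<mu> {x. real i / real (Suc n) \<le> g x})"
  proof (intro sum_mono vector_capacityD(3)[OF assms(1)] A(1) level)
    fix i assume "i \<in> {..<Suc n}"
    then have "real i / real (Suc n) \<le> 1" by simp
    then show "A \<subseteq> {x. real i / real (Suc n) \<le> g x}" using A(2) by auto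
  qed
  then have "(1 / real (Suc n)) *\<^sub>R (\<Sum>i<Suc n. \<mu> A) \<le>
      (1 / real (Suc n)) *\<^sub>R (\<Sum>i<Suc n. \<mu> {x. real i / real (Suc n) \<le> g x})"
    by (intro scaleR_left_mono) auto
  moreover have "(1 / real (Suc n)) *\<^sub>R (\<Sum>i<Suc n. \<mu> A) = \<mu> A"
    by (simp only: sum_constant_scaleR card_lessThan scaleR_scaleR) simp
  ultimately show "\<mu> A \<le> (1 / real (Suc n)) *\<^sub>R (\<Sum>i<Suc n. \<mu> {x. real i / real (Suc n) \<le> g x})"
    by (simp only:)
qed

text \<open>Level sets at positive heights lie in \<open>B\<close>. Only the term at height 0 may
  exceed \<open>\<mu> B\<close>; it is at most \<open>\<mu> UNIV\<close> and its weight
  \<open>1 / real (Suc n)\<close> vanishes in the limit.\<close>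

lemma J_le_representing_capacity:
  assumes "vector_capacity upper_level_sets \<mu>" "upper_continuous upper_level_sets \<mu>" "represents \<mu> I"
    and g: "continuous_on UNIV g" "\<And>x. 0 \<le> g x" "\<And>x. g x \<le> 1"
    and B: "B \<in> upper_level_sets" "\<And>x. x \<notin> B \<Longrightarrow> g x = 0"
  shows "J g \<le> \<mu> B"
proof (rule limit_mono[OF representing_capacity_riemann[OF assms(1-6)]])
  show "(\<lambda>n. \<mu> B + (1 / real (Suc n)) *\<^sub>R \<mu> UNIV) \<longlonglongrightarrow> \<mu> B"
  proof -
    have "(\<lambda>n. \<mu> B + (1 / real (Suc n)) *\<^sub>R \<mu> UNIV) \<longlonglongrightarrow> \<mu> B + 0 *\<^sub>R \<mu> UNIV"
      using LIMSEQ_inverse_real_of_nat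
      by (intro tendsto_add tendsto_scaleR tendsto_const) (simp add: divide_inverse)
    then show ?thesis by (simp only: scaleR_zero_left add_0_right)
  qed
  fix n
  have level: "{x. t \<le> g x} \<in> upper_level_sets" for t
    using upper_level_setI[of t "Bcontfun g"] by (simp add: apply_Bcontfun g)
  have B0: "0 \<le> \<mu> B" by (rule vector_capacityD(2)[OF assms(1) B(1)])
  have "(\<Sum>i<n. \<mu> {x. real (Suc i) / real (Suc n) \<le> g x}) \<le> (\<Sum>i<n. \<mu> B)"
  proof (intro sum_mono vector_capacityD(3)[OF assms(1)] B(1) level)
    fix i
    have "0 < real (Suc i) / real (Suc n)" by simp
    then have "0 < g x" if "real (Suc i) / real (Suc n) \<le> g x" for x
      using that by (rule less_le_trans)
    then show "{x. real (Suc i) / real (Suc n) \<le> g x} \<subseteq> B"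
      using B(2) by fastforce
  qed
  moreover have "\<mu> {x. real 0 / real (Suc n) \<le> g x} \<le> \<mu> UNIV"
    by (intro vector_capacityD(3)[OF assms(1)] level UNIV_upper_level_set) auto
  ultimately have "(\<Sum>i<Suc n. \<mu> {x. real i / real (Suc n) \<le> g x}) \<le> \<mu> UNIV + (\<Sum>i<n. \<mu> B)"
    unfolding sum.lessThan_Suc_shift by (intro add_mono)
  \<comment> \<open>One more copy of the positive \<open>\<mu> B\<close> brings the number of copies
    to \<open>Suc n\<close>, so that their average is \<open>\<mu> B\<close> itself.\<close>
  also have "\<dots> \<le> \<mu> UNIV + (\<Sum>i<Suc n. \<mu> B)"
    using B0 by simp
  finally have "(1 / real (Suc n)) *\<^sub>R (\<Sum>i<Suc n. \<mu> {x. real i / real (Suc n) \<le> g x}) \<le>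
      (1 / real (Suc n)) *\<^sub>R (\<mu> UNIV + (\<Sum>i<Suc n. \<mu> B))"
    by (intro scaleR_left_mono) auto
  also have "\<dots> = \<mu> B + (1 / real (Suc n)) *\<^sub>R \<mu> UNIV"
    by (simp only: sum_constant_scaleR card_lessThan scaleR_scaleR scaleR_add_right) simp
  finally show "(1 / real (Suc n)) *\<^sub>R (\<Sum>i<Suc n. \<mu> {x. real i / real (Suc n) \<le> g x}) \<le>
      \<mu> B + (1 / real (Suc n)) *\<^sub>R \<mu> UNIV" .
qed

lemma representing_capacity_eq_cap:
  assumes vc: "vector_capacity upper_level_sets \<mu>" and uc: "upper_continuous upper_level_sets \<mu>"
    and rep: "represents \<mu> I" and A: "A \<in> upper_level_sets"
  shows "\<mu> A = cap A"
proof (rule order_antisym)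
  show "\<mu> A \<le> cap A"
  proof (rule cap_greatest)
    fix h assume h: "h \<in> majorants A"
    note hD = majorantsD[OF h]
    \<comment> \<open>Cutting a majorant off at 1 makes it equal to 1 on \<open>A\<close>, as the
      comparison with Riemann sums requires.\<close>
    have c: "continuous_on UNIV (\<lambda>x. min (h x) 1)" by (intro continuous_intros hD)
    have "\<mu> A \<le> J (\<lambda>x. min (h x) 1)"
      using hD by (intro representing_capacity_le_J[OF vc uc rep c _ _ A]) (auto simp: min_absorb2)
    also have "\<dots> \<le> J h"
      by (intro J_mono c hD) simp
    finally show "\<mu> A \<le> J h" .
  qed
next
  obtain f :: "'a \<Rightarrow>\<^sub>C real" and t where A_eq: "A = {x. t \<le> f x}"
    using A unfolding upper_level_sets_def by blast
  define x where "x n = t - 1 / real (Suc n)" for n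
  have "x \<longlonglongrightarrow> t - 0"
    unfolding x_def using LIMSEQ_inverse_real_of_nat
    by (intro tendsto_diff tendsto_const) (simp add: divide_inverse)
  moreover have "x n \<le> t" for n by (simp add: x_def)
  ultimately have lim: "(\<lambda>n. \<mu> {y. x n \<le> f y}) \<longlonglongrightarrow> \<mu> A"
    unfolding A_eq
    by (intro continuous_within_tendsto_compose'[OF upper_level_left_continuous[OF vc uc]]) auto
  have "cap A \<le> \<mu> {y. x n \<le> f y}" for n
  proof -
    \<comment> \<open>A ramp in \<open>f\<close> of slope \<open>real (Suc n)\<close>: it equals 1
      on \<open>A\<close> and reaches 0 at the level \<open>x n\<close>, so \<open>g\<close>
      majorizes \<open>A\<close> and vanishes off the slightly larger level set.\<close>
    define g where "g y = max 0 (min 1 (1 + real (Suc n) * (f y - t)))" for y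
    have c: "continuous_on UNIV g" unfolding g_def by (auto intro!: continuous_intros)
    have "cap A \<le> J g"
      by (intro cap_le majorantsI c) (auto simp: g_def A_eq simp del: of_nat_Suc)
    also have "\<dots> \<le> \<mu> {y. x n \<le> f y}"
    proof (intro J_le_representing_capacity[OF vc uc rep c _ _ upper_level_setI])
      fix y assume "y \<notin> {y. x n \<le> f y}"
      then have "f y - t < - (1 / real (Suc n))" by (simp add: x_def del: of_nat_Suc)
      then have "real (Suc n) * (f y - t) < real (Suc n) * - (1 / real (Suc n))"
        by (intro mult_strict_left_mono) auto
      then show "g y = 0" by (simp add: g_def del: of_nat_Suc)
    qed (auto simp: g_def)
    finally show ?thesis .
  qed
  then show "cap A \<le> \<mu> A" by (rule limit_mono[OF tendsto_const lim])
qed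

lemma representing_capacity_eq_level_cap:
  assumes "vector_capacity upper_level_sets \<mu>" "upper_continuous upper_level_sets \<mu>" "represents \<mu> I"
  shows "\<mu> = level_cap"
proof
  fix A
  show "\<mu> A = level_cap A"
  proof (cases "A \<in> upper_level_sets")
    case True
    then show ?thesis
      by (simp add: level_cap_def representing_capacity_eq_cap[OF assms])
  next
    case False
    then show ?thesis
      using assms(1) unfolding vector_capacity_def level_cap_def by (auto dest: PiE_arb)
  qed
qed

section \<open>The regular extension to the Borel sets\<close>

text \<open>A continuous majorant of a set also majorizes its closure, so \<open>cap\<close> cannot
  tell a set from its closure. The values on closed sets are therefore kept and all others are
  rebuilt from inside.\<close>

definition inner_cap :: "'a set \<Rightarrow> 'e" where
  "inner_cap A = (THE v. isLub UNIV {cap K | K. closed K \<and> K \<subseteq> A} v)"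

text \<open>Finite unions of closed sets are closed, so the values are upward directed, with upper
  bound \<open>cap UNIV\<close>.\<close>

lemma isLub_inner_cap: "isLub UNIV {cap K | K. closed K \<and> K \<subseteq> A} (inner_cap A)"
proof -
  have "\<exists>v. isLub UNIV {cap K | K. closed K \<and> K \<subseteq> A} v"
  proof (rule upward_directed_isLub[OF order_continuous, of _ "cap UNIV"])
    show "{cap K | K. closed K \<and> K \<subseteq> A} \<noteq> {}" by blast
    show "u \<le> cap UNIV" if "u \<in> {cap K | K. closed K \<and> K \<subseteq> A}" for u
      using that by (auto intro: cap_mono)
    fix u v assume "u \<in> {cap K | K. closed K \<and> K \<subseteq> A}" "v \<in> {cap K | K. closed K \<and> K \<subseteq> A}"
    then obtain K L where KL: "closed K" "K \<subseteq> A" "closed L" "L \<subseteq> A" "u = cap K" "v = cap L" by blast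
    then have "cap (K \<union> L) \<in> {cap K | K. closed K \<and> K \<subseteq> A}" by blast
    moreover have "u \<le> cap (K \<union> L)" "v \<le> cap (K \<union> L)"
      using KL by (auto intro: cap_mono)
    ultimately show "\<exists>w\<in>{cap K | K. closed K \<and> K \<subseteq> A}. u \<le> w \<and> v \<le> w" by blast
  qed
  then obtain v where v: "isLub UNIV {cap K | K. closed K \<and> K \<subseteq> A} v" by blast
  show ?thesis
    unfolding inner_cap_def by (rule theI[of "isLub UNIV {cap K | K. closed K \<and> K \<subseteq> A}" v, OF v isLub_unique_order[OF _ v]])
qed

lemma cap_le_inner_cap: "closed K \<Longrightarrow> K \<subseteq> A \<Longrightarrow> cap K \<le> inner_cap A"
  using isLub_inner_cap[of A] unfolding isLub_UNIV_iff by blast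

lemma inner_cap_least: "(\<And>K. closed K \<Longrightarrow> K \<subseteq> A \<Longrightarrow> cap K \<le> z) \<Longrightarrow> inner_cap A \<le> z"
  using isLub_inner_cap[of A] unfolding isLub_UNIV_iff by blast

lemma inner_cap_closed: "closed K \<Longrightarrow> inner_cap K = cap K"
  by (intro order_antisym cap_le_inner_cap inner_cap_least cap_mono) auto

lemma inner_cap_mono: "A \<subseteq> B \<Longrightarrow> inner_cap A \<le> inner_cap B"
  by (intro inner_cap_least cap_le_inner_cap) auto

text \<open>Since \<open>inner_cap U \<le> cap U\<close>, the open neighbourhoods built from
  majorants of \<open>K\<close> already bring the infimum down to \<open>cap K\<close>.\<close>

lemma isGlb_inner_cap:
  assumes K: "closed K"
  shows "isGlb UNIV {inner_cap U | U. open U \<and> K \<subseteq> U} (cap K)"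
  unfolding isGlb_UNIV_iff
proof (intro conjI ballI allI impI)
  fix y assume "y \<in> {inner_cap U | U. open U \<and> K \<subseteq> U}"
  then show "cap K \<le> y" using K by (auto intro: cap_le_inner_cap)
next
  fix z assume z: "\<forall>y\<in>{inner_cap U | U. open U \<and> K \<subseteq> U}. z \<le> y"
  show "z \<le> cap K"
  proof (rule cap_greatest)
    fix h assume h: "h \<in> majorants K"
    show "z \<le> J h"
    proof (rule le_archimedean)
      fix n
      obtain U where U: "open U" "K \<subseteq> U" "cap U \<le> J h + (1 / real (Suc n)) *\<^sub>R J (\<lambda>_. 1)"
        using cap_open_neighbourhood[OF h] .
      have "z \<le> inner_cap U" using z U by blast
      also have "\<dots> \<le> cap U" by (intro inner_cap_least cap_mono)
      also note U(3)
      finally show "z \<le> J h + (1 / real (Suc n)) *\<^sub>R J (\<lambda>_. 1)" .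
    qed
  qed
qed

definition borel_cap :: "'a set \<Rightarrow> 'e" where
  "borel_cap = restrict inner_cap (sets borel)"

lemma vector_capacity_borel_cap: "vector_capacity (sets borel) borel_cap"
proof -
  have "0 \<le> inner_cap A" for A
    using cap_le_inner_cap[of "{}" A] by (simp add: cap_empty)
  then show ?thesis
    unfolding vector_capacity_def borel_cap_def set_lattice_def
    using inner_cap_mono inner_cap_closed[of "{}"] by (auto simp: cap_empty)
qed

lemma borel_cap_closed: "closed K \<Longrightarrow> borel_cap K = cap K"
  by (simp add: borel_cap_def inner_cap_closed)

lemma inner_regular_borel_cap: "inner_regular borel_cap"
  unfolding inner_regular_def
proof
  fix A :: "'a set" assume A: "A \<in> sets borel"
  have "{borel_cap K | K. closed K \<and> K \<subseteq> A} = {cap K | K. closed K \<and> K \<subseteq> A}"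
    using borel_cap_closed by force
  then show "isLub UNIV {borel_cap K | K. closed K \<and> K \<subseteq> A} (borel_cap A)"
    using A isLub_inner_cap[of A] by (simp add: borel_cap_def)
qed

lemma outer_regular_borel_cap: "outer_regular_closed borel_cap"
  unfolding outer_regular_closed_def
proof (intro allI impI)
  fix K :: "'a set" assume K: "closed K"
  have "{borel_cap U | U. open U \<and> K \<subseteq> U} = {inner_cap U | U. open U \<and> K \<subseteq> U}"
    unfolding borel_cap_def by force
  then show "isGlb UNIV {borel_cap U | U. open U \<and> K \<subseteq> U} (borel_cap K)"
    using isGlb_inner_cap[OF K] by (simp add: borel_cap_closed K)
qed

text \<open>
  By Urysohn's lemma the upper level sets lie cofinally between a closed set and its open
  neighbourhoods, so (R2) recovers the value on closed sets from the values on upper level sets.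
\<close>

lemma outer_regular_isGlb_upper_level_sets:
  fixes \<nu> :: "'a set \<Rightarrow> 'e"
  assumes vc: "vector_capacity (sets borel) \<nu>" and reg: "outer_regular_closed \<nu>" and K: "closed K"
  shows "isGlb UNIV (\<nu> ` {A \<in> upper_level_sets. K \<subseteq> A}) (\<nu> K)"
  unfolding isGlb_UNIV_iff
proof (intro conjI ballI allI impI)
  fix y assume "y \<in> \<nu> ` {A \<in> upper_level_sets. K \<subseteq> A}"
  then show "\<nu> K \<le> y"
    using K by (auto intro!: vector_capacityD(3)[OF vc] borel_closed closed_upper_level_set)
next
  fix z assume z: "\<forall>y\<in>\<nu> ` {A \<in> upper_level_sets. K \<subseteq> A}. z \<le> y"
  have "z \<le> \<nu> U" if U: "open U" "K \<subseteq> U" for U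
  proof -
    obtain A where A: "A \<in> upper_level_sets" "K \<subseteq> A" "A \<subseteq> U"
      using Urysohn_upper_level_set[OF compact_UNIV K U] .
    then have "z \<le> \<nu> A" using z by blast
    also have "\<dots> \<le> \<nu> U"
      using A U by (intro vector_capacityD(3)[OF vc] borel_closed borel_open closed_upper_level_set) auto
    finally show ?thesis .
  qed
  then have lb: "\<forall>y\<in>{\<nu> U | U. open U \<and> K \<subseteq> U}. z \<le> y" by blast
  have "isGlb UNIV {\<nu> U | U. open U \<and> K \<subseteq> U} (\<nu> K)"
    using reg K unfolding outer_regular_closed_def by simp
  then show "z \<le> \<nu> K"
    using lb unfolding isGlb_UNIV_iff by simp
qed

text \<open>(R2) determines the values on closed sets from those on upper level sets, and (R1) then
  determines the values on Borel sets. Elsewhere both functions are \<open>undefined\<close> by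
  extensionality.\<close>

lemma regular_extension_unique:
  fixes \<nu> \<nu>' :: "'a set \<Rightarrow> 'e"
  assumes vc: "vector_capacity (sets borel) \<nu>" "vector_capacity (sets borel) \<nu>'"
    and eq: "\<And>A. A \<in> upper_level_sets \<Longrightarrow> \<nu> A = \<nu>' A"
    and inner: "inner_regular \<nu>" "inner_regular \<nu>'"
    and outer: "outer_regular_closed \<nu>" "outer_regular_closed \<nu>'"
  shows "\<nu> = \<nu>'"
proof
  have closed_eq: "\<nu> K = \<nu>' K" if K: "closed K" for K
  proof -
    have "\<nu> ` {A \<in> upper_level_sets. K \<subseteq> A} = \<nu>' ` {A \<in> upper_level_sets. K \<subseteq> A}"
      using eq by (intro image_cong) auto
    with outer_regular_isGlb_upper_level_sets[OF vc(1) outer(1) K]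
    show ?thesis
      by (intro isGlb_unique_order[OF _ outer_regular_isGlb_upper_level_sets[OF vc(2) outer(2) K]]) simp
  qed
  fix A
  show "\<nu> A = \<nu>' A"
  proof (cases "A \<in> sets borel")
    case True
    have eq: "{\<nu> K | K. closed K \<and> K \<subseteq> A} = {\<nu>' K | K. closed K \<and> K \<subseteq> A}"
      using closed_eq by force
    have "isLub UNIV {\<nu>' K | K. closed K \<and> K \<subseteq> A} (\<nu> A)"
      using inner(1) True unfolding inner_regular_def eq[symmetric] by simp
    moreover have "isLub UNIV {\<nu>' K | K. closed K \<and> K \<subseteq> A} (\<nu>' A)"
      using inner(2) True unfolding inner_regular_def by simp
    ultimately show ?thesis by (rule isLub_unique_order)
  next
    case False
    then show ?thesis
      using vc unfolding vector_capacity_def by (auto dest!: PiE_arb)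
  qed
qed

end

theorem theorem3:
  fixes I :: "('a::t2_space \<Rightarrow>\<^sub>C real) \<Rightarrow> 'e::banach_lattice"
  assumes "compact (UNIV :: 'a set)"
    and "order_continuous_norm TYPE('e)"
    and "comonotonic_additive I"
    and "monotone_operator I"
    and "I (const_bcontfun 1) > 0"
  shows "(\<exists>!\<mu>. vector_capacity upper_level_sets \<mu> \<and> upper_continuous upper_level_sets \<mu> \<and>
             represents \<mu> I) \<and>
         (\<forall>\<mu>. vector_capacity upper_level_sets \<mu> \<and> upper_continuous upper_level_sets \<mu> \<and>
             represents \<mu> I \<longrightarrow>
             (\<exists>!\<nu>. vector_capacity (sets borel) \<nu> \<and> (\<forall>A\<in>upper_level_sets. \<nu> A = \<mu> A) \<and>
                  inner_regular \<nu> \<and> outer_regular_closed \<nu>))"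
proof -
  interpret comonotonic_operator I
    using assms by unfold_locales
  \<comment> \<open>Since every representing capacity is \<open>level_cap\<close>, the extension
    claim has to be checked for this capacity alone.\<close>
  have unique: "\<mu> = level_cap"
    if "vector_capacity upper_level_sets \<mu> \<and> upper_continuous upper_level_sets \<mu> \<and> represents \<mu> I" for \<mu>
    using that representing_capacity_eq_level_cap by blast
  have ex1: "\<exists>!\<mu>. vector_capacity upper_level_sets \<mu> \<and> upper_continuous upper_level_sets \<mu> \<and> represents \<mu> I"
    using vector_capacity_level_cap upper_continuous_level_cap represents_level_cap unique
    by (intro ex1I[of _ level_cap] conjI)
  have extends: "\<forall>A\<in>upper_level_sets. borel_cap A = level_cap A"
    by (simp add: borel_cap_closed closed_upper_level_set level_cap_def)
  have ext1: "\<exists>!\<nu>. vector_capacity (sets borel) \<nu> \<and> (\<forall>A\<in>upper_level_sets. \<nu> A = level_cap A) \<and>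
      inner_regular \<nu> \<and> outer_regular_closed \<nu>"
  proof (rule ex1I[of _ borel_cap])
    show "vector_capacity (sets borel) borel_cap \<and> (\<forall>A\<in>upper_level_sets. borel_cap A = level_cap A) \<and>
      inner_regular borel_cap \<and> outer_regular_closed borel_cap"
      by (intro conjI vector_capacity_borel_cap extends inner_regular_borel_cap outer_regular_borel_cap)
    fix \<nu> :: "'a set \<Rightarrow> 'e"
    assume \<nu>: "vector_capacity (sets borel) \<nu> \<and> (\<forall>A\<in>upper_level_sets. \<nu> A = level_cap A) \<and>
      inner_regular \<nu> \<and> outer_regular_closed \<nu>"
    show "\<nu> = borel_cap"
    proof (rule regular_extension_unique)
      show "\<nu> A = borel_cap A" if "A \<in> upper_level_sets" for A
        using \<nu> extends that by simp
    qed (use \<nu> vector_capacity_borel_cap inner_regular_borel_cap outer_regular_borel_cap in simp_all)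
  qed
  show ?thesis
  proof (intro conjI allI impI)
    fix \<mu> :: "'a set \<Rightarrow> 'e"
    assume "vector_capacity upper_level_sets \<mu> \<and> upper_continuous upper_level_sets \<mu> \<and> represents \<mu> I"
    then have "\<mu> = level_cap" by (rule unique)
    with ext1 show "\<exists>!\<nu>. vector_capacity (sets borel) \<nu> \<and> (\<forall>A\<in>upper_level_sets. \<nu> A = \<mu> A) \<and>
        inner_regular \<nu> \<and> outer_regular_closed \<nu>" by simp
  qed (rule ex1)
qed

end
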